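(* Let $\lambda$ be either $\aleph_0$ or a strong limit cardinal of cofinality $\aleph_0$. Let $\langle G_m,\pi_{m,n}: m\le n<\omega\rangle$ be an inverse system of groups with each $|G_n|<\lambda$, where $\pi_{m,n}:G_n\to G_m$ are homomorphisms with $\pi_{\alpha,\beta}\circ\pi_{\beta,\gamma}=\pi_{\alpha,\gamma}$ for $\alpha\le\beta\le\gamma$ and $\pi_{\alpha,\alpha}$ the identity; let $G_\omega$ with maps $\pi_{n,\omega}:G_\omega\to G_n$ be its inverse limit. Let $\mathbf I$ be a finite index set, and for each $t\in\mathbf I$ let $\langle H^t_m,\pi^t_{m,n}: m\le n<\omega\rangle$ be an inverse system of groups with each $|H^t_n|<\lambda$ (same conventions), with inverse limit $H^t_\omega$ and maps $\pi^t_{n,\omega}$. For each $t\in\mathbf I$ and $n<\omega$ let $\sigma^t_n:H^t_n\to G_n$ be a homomorphism such that $\pi_{m,n}\circ\sigma^t_n=\sigma^t_m\circ\pi^t_{m,n}$ for all $m\le n<\omega$, and let $\sigma^t_\omega:H^t_\omega\to G_\omega$ be the induced homomorphism. Assume that for every cardinal $\mu<\lambda$ there is a sequence $\langle f_i\in G_\omega: i<\mu\rangle$ such that for all $i\ne j<\mu$ and all $t\in\mathbf I$, $f_if_j^{-1}\notin\operatorname{Rang}(\sigma^t_\omega)$. Then there is a sequence $\langle f_i\in G_\omega: i<2^\lambda\rangle$ such that for all $i\ne j<2^\lambda$ and all $t\in\mathbf I$, $f_if_j^{-1}\notin\operatorname{Rang}(\sigma^t_\omega)$.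
   Context: The groups need not be abelian. A strong limit cardinal $\lambda$ is one with $2^\kappa<\lambda$ for all $\kappa<\lambda$. *)

theory Defs
  imports "HOL-Algebra.Product_Groups"
begin

unbundle cardinal_syntax

text \<open>
  A cardinal is a relation \<^term>\<open>r\<close> with \<^term>\<open>Card_order r\<close>; the ordinals below it are represented
  by the elements of \<^term>\<open>Field r\<close>. Every cardinal below \<open>r :: 'k rel\<close> is order-isomorphic to a
  cardinal on a subset of the same type \<open>'k\<close>, so quantifying over relations on \<open>'k\<close> covers all of
  them.
\<close>

definition strong_limit_card :: "'k rel \<Rightarrow> bool" where
  "strong_limit_card r \<longleftrightarrow>
     Card_order r \<and> (\<forall>k :: 'k rel. Card_order k \<and> k <o r \<longrightarrow> ctwo ^c k <o r)"

text \<open>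
  \<^const>\<open>cofinal\<close> asks for strict upper bounds. On an infinite cardinal this agrees with the usual
  non-strict notion, since there is no greatest element.
\<close>

definition has_cofinality :: "'k rel \<Rightarrow> 'c rel \<Rightarrow> bool" where
  "has_cofinality r c \<longleftrightarrow>
     (\<exists>A \<subseteq> Field r. cofinal A r \<and> |A| =o c) \<and>
     (\<forall>A \<subseteq> Field r. cofinal A r \<longrightarrow> c \<le>o |A| )"

definition inverse_system :: "(nat \<Rightarrow> 'a monoid) \<Rightarrow> (nat \<Rightarrow> nat \<Rightarrow> 'a \<Rightarrow> 'a) \<Rightarrow> bool" where
  "inverse_system G \<pi> \<longleftrightarrow>
     (\<forall>n. group (G n)) \<and>
     (\<forall>m n. m \<le> n \<longrightarrow> \<pi> m n \<in> hom (G n) (G m)) \<and>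
     (\<forall>n. \<forall>x\<in>carrier (G n). \<pi> n n x = x) \<and>
     (\<forall>k m n. k \<le> m \<longrightarrow> m \<le> n \<longrightarrow> (\<forall>x\<in>carrier (G n). \<pi> k m (\<pi> m n x) = \<pi> k n x))"

definition inverse_limit :: "(nat \<Rightarrow> 'a monoid) \<Rightarrow> (nat \<Rightarrow> nat \<Rightarrow> 'a \<Rightarrow> 'a) \<Rightarrow> (nat \<Rightarrow> 'a) monoid" where
  "inverse_limit G \<pi> =
     (product_group UNIV G)
       \<lparr>carrier := {x \<in> carrier (product_group UNIV G). \<forall>m n. m \<le> n \<longrightarrow> \<pi> m n (x n) = x m}\<rparr>"

definition limit_proj :: "nat \<Rightarrow> (nat \<Rightarrow> 'a) \<Rightarrow> 'a" where
  "limit_proj n x = x n"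

definition inverse_system_hom ::
  "(nat \<Rightarrow> 'b monoid) \<Rightarrow> (nat \<Rightarrow> nat \<Rightarrow> 'b \<Rightarrow> 'b) \<Rightarrow> (nat \<Rightarrow> 'a monoid) \<Rightarrow> (nat \<Rightarrow> nat \<Rightarrow> 'a \<Rightarrow> 'a)
    \<Rightarrow> (nat \<Rightarrow> 'b \<Rightarrow> 'a) \<Rightarrow> bool" where
  "inverse_system_hom H \<rho> G \<pi> \<sigma> \<longleftrightarrow>
     (\<forall>n. \<sigma> n \<in> hom (H n) (G n)) \<and>
     (\<forall>m n. m \<le> n \<longrightarrow> (\<forall>x\<in>carrier (H n). \<pi> m n (\<sigma> n x) = \<sigma> m (\<rho> m n x)))"

definition limit_map :: "(nat \<Rightarrow> 'b \<Rightarrow> 'a) \<Rightarrow> (nat \<Rightarrow> 'b) \<Rightarrow> nat \<Rightarrow> 'a" where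
  "limit_map \<sigma> x = (\<lambda>n. \<sigma> n (x n))"

lemma carrier_inverse_limit:
  "carrier (inverse_limit G \<pi>) =
     {x. (\<forall>n. x n \<in> carrier (G n)) \<and> (\<forall>m n. m \<le> n \<longrightarrow> \<pi> m n (x n) = x m)}"
  by (auto simp: inverse_limit_def)

lemma mult_inverse_limit: "x \<otimes>\<^bsub>inverse_limit G \<pi>\<^esub> y = (\<lambda>n. x n \<otimes>\<^bsub>G n\<^esub> y n)"
  by (simp add: inverse_limit_def fun_eq_iff)

lemma group_inverse_limit:
  assumes "inverse_system G \<pi>"
  shows "group (inverse_limit G \<pi>)"
proof -
  have G: "\<And>n. group (G n)" and h: "\<And>m n. m \<le> n \<Longrightarrow> group_hom (G n) (G m) (\<pi> m n)"
    using assms by (auto simp: inverse_system_def group_hom_def group_hom_axioms_def)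
  have h_inv: "\<pi> m n (inv\<^bsub>G n\<^esub> x) = inv\<^bsub>G m\<^esub> (\<pi> m n x)"
    and h_mult: "y \<in> carrier (G n) \<Longrightarrow> \<pi> m n (x \<otimes>\<^bsub>G n\<^esub> y) = \<pi> m n x \<otimes>\<^bsub>G m\<^esub> \<pi> m n y"
    if "m \<le> n" "x \<in> carrier (G n)" for m n x y
    using group_hom.hom_inv[OF h] group_hom.hom_mult[OF h] that by blast+
  let ?P = "product_group UNIV G"
  have P: "group ?P"
    using G by simp
  have "subgroup (carrier (inverse_limit G \<pi>)) ?P"
  proof (rule group.subgroupI[OF P])
    show "carrier (inverse_limit G \<pi>) \<subseteq> carrier ?P"
      by (auto simp: inverse_limit_def)
    have "(\<lambda>n. \<one>\<^bsub>G n\<^esub>) \<in> carrier (inverse_limit G \<pi>)"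
      using G h by (auto simp: carrier_inverse_limit group.is_monoid group_hom.hom_one)
    then show "carrier (inverse_limit G \<pi>) \<noteq> {}" by blast
  next
    fix x assume x: "x \<in> carrier (inverse_limit G \<pi>)"
    then have "inv\<^bsub>?P\<^esub> x = (\<lambda>n\<in>UNIV. inv\<^bsub>G n\<^esub> x n)"
      using G by (intro inv_product_group) (auto simp: carrier_inverse_limit)
    then show "inv\<^bsub>?P\<^esub> x \<in> carrier (inverse_limit G \<pi>)"
      using x G by (auto simp: carrier_inverse_limit h_inv)
  next
    fix x y assume "x \<in> carrier (inverse_limit G \<pi>)" "y \<in> carrier (inverse_limit G \<pi>)"
    then show "x \<otimes>\<^bsub>?P\<^esub> y \<in> carrier (inverse_limit G \<pi>)"
      using G by (auto simp: carrier_inverse_limit h_mult group.is_monoid monoid.m_closed)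
  qed
  then have "group (?P\<lparr>carrier := carrier (inverse_limit G \<pi>)\<rparr>)"
    by (rule subgroup.subgroup_is_group[OF _ P])
  then show ?thesis
    by (simp add: inverse_limit_def)
qed

lemma limit_proj_hom: "limit_proj n \<in> hom (inverse_limit G \<pi>) (G n)"
  by (auto simp: hom_def limit_proj_def carrier_inverse_limit mult_inverse_limit)

lemma limit_proj_compatible:
  "\<lbrakk>x \<in> carrier (inverse_limit G \<pi>); m \<le> n\<rbrakk> \<Longrightarrow> \<pi> m n (limit_proj n x) = limit_proj m x"
  by (simp add: carrier_inverse_limit limit_proj_def)

lemma limit_map_hom:
  assumes "inverse_system_hom H \<rho> G \<pi> \<sigma>"
  shows "limit_map \<sigma> \<in> hom (inverse_limit H \<rho>) (inverse_limit G \<pi>)"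
  using assms
  by (auto simp: inverse_system_hom_def hom_def limit_map_def carrier_inverse_limit
      mult_inverse_limit Pi_iff)

lemma limit_map_unique:
  assumes "\<And>n. limit_proj n (f x) = \<sigma> n (limit_proj n x)"
  shows "f x = limit_map \<sigma> x"
  using assms by (auto simp: limit_map_def limit_proj_def)

end

theory Submission
  imports Defs
begin

text \<open>
  Filter \<open>G\<^sub>\<omega>\<close> by the kernels \<open>U\<^sub>n\<close> of the projections to \<open>G\<^sub>n\<close>; they have index below \<open>\<lambda>\<close> and
  \<open>G\<^sub>\<omega>\<close> is complete. For one \<open>t\<close> let \<open>R\<close> be the range of \<open>\<sigma>\<^sub>\<omega>\<close>, of index at least \<open>\<lambda>\<close>, and \<open>K\<^sub>n\<close>
  the image of the kernel of \<open>H\<^sub>\<omega> \<rightarrow> H\<^sub>n\<close>. Consider complete filtrations \<open>V\<close> by subgroups of index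
  below \<open>\<lambda>\<close>, normalised by \<open>R\<close>, with \<open>K\<^sub>n \<subseteq> V\<^sub>n \<subseteq> U\<^sub>n\<close>. One that is fixed by the operation
  \<open>V\<^sub>n \<mapsto> \<Inter>\<^sub>m K\<^sub>n V\<^sub>m\<close> would satisfy \<open>V\<^sub>0 \<subseteq> R\<close> by the open mapping argument, which is impossible.
  So by Zorn's lemma the refinement breaks down, either at one such closure or along a chain, because
  some index reaches \<open>\<lambda>\<close>. Either way there are a complete filtration \<open>W\<close> and subgroups \<open>L\<^sub>m \<supseteq> W\<^sub>m\<close>,
  all containing one \<open>K\<^sub>n\<close>, of indices below \<open>\<lambda>\<close> but unbounded in \<open>\<lambda>\<close>.

  By B. H. Neumann's covering lemma the finitely many \<open>t\<close> can be treated at once, and a tree of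
  height \<open>\<omega>\<close> of convergent products gives \<open>2\<^sup>\<lambda>\<close> elements that are pairwise incongruent modulo
  each of these \<open>K\<^sub>n\<close>. As \<open>K\<^sub>n\<close> has index below \<open>\<lambda>\<close> in \<open>R\<close>, congruence modulo some \<open>R\<close> is a graph of
  degree below \<open>\<lambda>\<close> on these elements, so a maximal independent set still has \<open>2\<^sup>\<lambda>\<close> members.
\<close>

section \<open>Strong limit cardinals of countable cofinality\<close>

lemma card_of_Pow_mono:
  assumes "|A| \<le>o |B|"
  shows "|Pow A| \<le>o |Pow B|"
proof -
  obtain f where "inj_on f A" "f ` A \<subseteq> B"
    using assms card_of_ordLeq by metis
  then have "inj_on (image f) (Pow A)" "image f ` Pow A \<subseteq> Pow B"
    using inj_on_image_Pow image_Pow_mono by blast+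
  then show ?thesis
    using card_of_ordLeq by blast
qed

locale strong_limit_omega =
  fixes lam :: "'k rel"
  assumes card_lam: "Card_order lam"
    and infinite_lam: "infinite (Field lam)"
    and Pow_less_lam: "\<And>M :: 'k set. |M| <o lam \<Longrightarrow> |Pow M| <o lam"
    and countable_cofinal: "\<exists>a :: nat \<Rightarrow> 'k. range a \<subseteq> Field lam \<and> cofinal (range a) lam"
begin

lemma Well_order_lam: "Well_order lam"
  using card_lam by (simp add: card_order_on_def)

lemma not_small_iff: "\<not> |X| <o lam \<longleftrightarrow> lam \<le>o |X|"
  using not_ordLess_iff_ordLeq[OF Well_order_lam card_of_Well_order] .

lemma small_mono: "|X| \<le>o |Y| \<Longrightarrow> |Y| <o lam \<Longrightarrow> |X| <o lam"
  by (rule ordLeq_ordLess_trans)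

lemma small_copy:
  assumes "|X| <o lam"
  obtains M :: "'k set" where "|X| =o |M|" "|M| <o lam"
proof -
  obtain M :: "'k set" where "|X| =o |M|"
    using internalize_card_of_ordLess[of X lam] assms by blast
  then show thesis
    using assms that ordIso_ordLess_trans ordIso_symmetric by blast
qed

lemma small_finite: "finite X \<Longrightarrow> |X| <o lam"
  using infinite_lam Well_order_lam
  by (intro finite_ordLess_infinite) (auto simp: Field_card_of card_of_well_order_on)

lemma small_Pow:
  assumes "|X| <o lam"
  shows "|Pow X| <o lam"
proof -
  obtain M :: "'k set" where M: "|X| =o |M|" "|M| <o lam"
    using small_copy[OF assms] .
  then show ?thesis
    using small_mono[OF card_of_Pow_mono Pow_less_lam] ordIso_iff_ordLeq by blast
qed

lemma small_Plus: "|X| <o lam \<Longrightarrow> |Y| <o lam \<Longrightarrow> |X <+> Y| <o lam"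
  by (rule card_of_Plus_ordLess_infinite_Field[OF infinite_lam card_lam])

lemma small_Times:
  assumes "|X| <o lam" "|Y| <o lam"
  shows "|X \<times> Y| <o lam"
proof -
  have "inj_on (\<lambda>(x, y). {Inl x, Inr y}) (X \<times> Y)"
    by (auto simp: inj_on_def doubleton_eq_iff)
  then have "|X \<times> Y| \<le>o |Pow (X <+> Y)|"
    by (rule card_of_ordLeqI) auto
  then show ?thesis
    using small_mono small_Pow[OF small_Plus[OF assms]] by blast
qed

lemma small_Sigma_finite:
  assumes "finite I" "\<And>t. t \<in> I \<Longrightarrow> |B t| <o lam"
  shows "|SIGMA t:I. B t| <o lam"
  using assms
proof (induction I rule: finite_induct)
  case empty
  then show ?case by (simp add: small_finite)
next
  case (insert t I)
  have "(SIGMA s:insert t I. B s) = {t} \<times> B t \<union> (SIGMA s:I. B s)"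
    by auto
  moreover have "|{t} \<times> B t| <o lam"
    using small_Times[OF small_finite] insert.prems by blast
  ultimately show ?case
    using card_of_Un_ordLess_infinite_Field[OF infinite_lam card_lam] insert by simp
qed

lemma cofinal_small_sets:
  obtains A :: "nat \<Rightarrow> 'k set" where "\<And>n. |A n| <o lam" "(\<Union>n. A n) = Field lam"
    "\<And>M :: 'k set. |M| <o lam \<Longrightarrow> \<exists>n. |M| \<le>o |A n|"
proof -
  obtain a :: "nat \<Rightarrow> 'k" where a: "range a \<subseteq> Field lam" "cofinal (range a) lam"
    using countable_cofinal by blast
  have cofinal: "\<exists>n. x \<in> underS lam (a n)" if "x \<in> Field lam" for x
    using a(2) that by (auto simp: cofinal_def underS_def)
  show thesis
  proof (rule that)
    show "|underS lam (a n)| <o lam" for n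
      using card_of_underS[OF card_lam] a(1) by blast
    show "(\<Union>n. underS lam (a n)) = Field lam"
      using cofinal by (auto simp: underS_def Field_def)
    fix M :: "'k set" assume "|M| <o lam"
    then obtain x where x: "x \<in> Field lam" "|M| =o Restr lam (underS lam x)"
      using ordLess_iff_ordIso_Restr[OF Well_order_lam card_of_Well_order] by blast
    have "|M| =o |Field (Restr lam (underS lam x))|"
      using card_of_cong[OF x(2)] by (simp add: Field_card_of)
    also have "|Field (Restr lam (underS lam x))| \<le>o |underS lam x|"
      by (rule card_of_mono1) (auto simp: Field_def)
    finally have M_le: "|M| \<le>o |underS lam x|" .
    obtain n where "x \<in> underS lam (a n)"
      using cofinal[OF x(1)] by blast
    then have "underS lam x \<subseteq> underS lam (a n)"
      using Well_order_lam underS_incr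
      by (metis (no_types, lifting) order_on_defs(1-3) underS_E well_order_on_def)
    then show "\<exists>n. |M| \<le>o |underS lam (a n)|"
      using M_le card_of_mono1 ordLeq_transitive by blast
  qed
qed

lemma Pow_ordLeq_if_ordLeq_Times_small:
  assumes "|Pow (Field lam)| \<le>o |S \<times> Q|" "|Q| <o lam"
  shows "|Pow (Field lam)| \<le>o |S|"
proof -
  have "\<not> |S| <o lam"
  proof
    assume "|S| <o lam"
    then have "|Pow (Field lam)| <o lam"
      using small_mono[OF assms(1) small_Times[OF _ assms(2)]] by blast
    then show False
      using Card_order_Pow[OF card_lam] ordLess_transitive ordLess_irreflexive by blast
  qed
  then have "infinite S" and "lam \<le>o |S|"
    using small_finite not_small_iff by blast+
  then have "|Q| \<le>o |S|"
    using assms(2) ordLess_ordLeq_trans ordLess_imp_ordLeq by blast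
  then have "|S \<times> Q| \<le>o |S|"
    using \<open>infinite S\<close> by (intro card_of_Times_ordLeq_infinite_Field)
      (simp_all add: Field_card_of card_of_card_order_on card_of_mono1)
  then show ?thesis
    using assms(1) ordLeq_transitive by blast
qed

end

lemma Pow_Field_ordIso_ctwo_cexp: "|Pow (Field r)| =o ctwo ^c r"
  unfolding ctwo_def cexp_def Field_card_of by (rule card_of_Pow_Func)

lemma strong_limit_omega_if_ordIso_natLeq:
  fixes lam :: "'k rel"
  assumes card: "Card_order lam" and nat: "lam =o natLeq"
  shows "strong_limit_omega lam"
proof -
  have "|UNIV :: nat set| =o |Field lam|"
    using card_of_Field_ordIso[OF card] card_of_nat nat ordIso_symmetric ordIso_transitive by metis
  then obtain a :: "nat \<Rightarrow> 'k" where a: "bij_betw a UNIV (Field lam)"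
    using card_of_ordIso by blast
  show ?thesis
  proof
    show infinite: "infinite (Field lam)"
      using a bij_betw_finite infinite_UNIV_nat by blast
    have small_iff_finite: "|M| <o lam \<longleftrightarrow> finite M" for M :: "'k set"
      using nat finite_iff_ordLess_natLeq ordLess_ordIso_trans ordIso_symmetric by metis
    show "|Pow M| <o lam" if "|M| <o lam" for M :: "'k set"
      using that nat small_iff_finite finite_iff_ordLess_natLeq ordLess_ordIso_trans
      by (metis finite_Pow_iff ordIso_symmetric)
    have "cofinal (Field lam) lam"
      using infinite_Card_order_limit[OF card infinite] by (auto simp: cofinal_def)
    then show "\<exists>a :: nat \<Rightarrow> 'k. range a \<subseteq> Field lam \<and> cofinal (range a) lam"
      using bij_betw_imp_surj_on[OF a] by (intro exI[of _ a]) simp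
  qed (fact card)
qed

lemma strong_limit_omega_if_strong_limit_card:
  fixes lam :: "'k rel"
  assumes strong_limit: "strong_limit_card lam" and cofinality: "has_cofinality lam natLeq"
  shows "strong_limit_omega lam"
proof -
  obtain A where A: "A \<subseteq> Field lam" "cofinal A lam" "|A| =o natLeq"
    using cofinality by (auto simp: has_cofinality_def)
  have "|UNIV :: nat set| =o |A|"
    using A(3) card_of_nat ordIso_symmetric ordIso_transitive by blast
  then obtain a :: "nat \<Rightarrow> 'k" where a: "bij_betw a UNIV A"
    using card_of_ordIso by metis
  show ?thesis
  proof
    show "Card_order lam"
      using strong_limit by (simp add: strong_limit_card_def)
    show "infinite (Field lam)"
      using A(1) a by (metis bij_betw_finite finite_subset infinite_UNIV_nat)
    show "|Pow M| <o lam" if "|M| <o lam" for M :: "'k set"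
    proof -
      have "ctwo ^c |M| <o lam"
        using strong_limit that card_of_Card_order by (auto simp: strong_limit_card_def)
      then show ?thesis
        using Pow_Field_ordIso_ctwo_cexp[of "|M|"] ordIso_ordLess_trans by (simp add: Field_card_of)
    qed
    show "\<exists>a :: nat \<Rightarrow> 'k. range a \<subseteq> Field lam \<and> cofinal (range a) lam"
      using A bij_betw_imp_surj_on[OF a] by auto
  qed
qed

section \<open>Chains and independent sets\<close>

lemma card_of_Un_image_Times_ordLeq:
  assumes "|S| \<le>o |M|"
  shows "|S \<union> f ` (S \<times> S)| \<le>o |M <+> M \<times> M|"
proof -
  have "|S \<union> f ` (S \<times> S)| \<le>o |S <+> f ` (S \<times> S)|"
    by (rule card_of_Un_Plus_ordLeq)
  also have "|S <+> f ` (S \<times> S)| \<le>o |M <+> S \<times> S|"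
    using assms card_of_image by (rule card_of_Plus_mono)
  also have "|M <+> S \<times> S| \<le>o |M <+> M \<times> M|"
    using ordLeq_transitive[OF card_of_Times_mono1[OF assms] card_of_Times_mono2[OF assms]]
    by (rule card_of_Plus_mono2)
  finally show ?thesis .
qed

lemma large_subset_of_chain_coinitial:
  assumes D: "chain\<^sub>\<subseteq> D" and T: "T \<subseteq> D" "|K| <o |T|" and V: "V \<in> D"
    and above: "|{W \<in> D. V \<subseteq> W}| \<le>o |K|"
  shows "\<exists>W\<in>T. W \<subseteq> V"
proof (rule ccontr)
  assume "\<not> ?thesis"
  then have "T \<subseteq> {W \<in> D. V \<subseteq> W}"
    using D V T(1) unfolding chain_subset_def by blast
  then have "|T| \<le>o |K|"
    using above card_of_mono1 ordLeq_transitive by blast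
  then show False
    using T(2) not_ordLess_ordLeq by blast
qed

lemma card_of_chain_ordLeq:
  fixes D :: "'a set set"
  assumes "chain\<^sub>\<subseteq> D"
    and above: "\<And>W. W \<in> D \<Longrightarrow> |{V \<in> D. W \<subseteq> V}| \<le>o |K|"
  shows "|D| \<le>o |Pow K \<times> K|"
proof (cases "|D| \<le>o |Pow K|")
  case True
  show ?thesis
  proof (cases "K = {}")
    case True
    then have "D = {}"
      using above card_of_empty3 by fastforce
    then show ?thesis by (simp add: card_of_empty)
  next
    case False
    then show ?thesis
      using ordLeq_transitive[OF \<open>|D| \<le>o |Pow K|\<close> card_of_Times1[OF False]] by blast
  qed
next
  case False
  then have "|Pow K| \<le>o |D|"
    using ordLeq_total[OF card_of_Well_order card_of_Well_order] by blast
  then obtain T where T: "T \<subseteq> D" "|Pow K| =o |T|"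
    using internalize_card_of_ordLeq2[of "Pow K" D] by blast
  have "|K| <o |T|"
    using card_of_Pow T(2) by (rule ordLess_ordIso_trans)
  then have "\<exists>W\<in>T. W \<subseteq> V" if "V \<in> D" for V
    using large_subset_of_chain_coinitial[OF assms(1) T(1) _ that above[OF that]] by blast
  then have "|D| \<le>o |\<Union>W\<in>T. {V \<in> D. W \<subseteq> V}|"
    by (intro card_of_mono1) blast
  also have "|\<Union>W\<in>T. {V \<in> D. W \<subseteq> V}| \<le>o |SIGMA W:T. {V \<in> D. W \<subseteq> V}|"
    by (rule card_of_UNION_Sigma)
  also have "|SIGMA W:T. {V \<in> D. W \<subseteq> V}| \<le>o |T \<times> K|"
    using above T(1) by (intro card_of_Sigma_mono1) blast
  also have "|T \<times> K| \<le>o |Pow K \<times> K|"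
    using T(2) ordIso_iff_ordLeq by (intro card_of_Times_mono1) blast
  finally show ?thesis .
qed

lemma first_trace_difference:
  fixes A :: "nat \<Rightarrow> 'a set"
  assumes "X \<subseteq> (\<Union>n. A n)" "Y \<subseteq> (\<Union>n. A n)" "X \<noteq> Y"
  shows "\<exists>n. X \<inter> A n \<noteq> Y \<inter> A n \<and> (\<forall>i<n. X \<inter> A i = Y \<inter> A i)"
proof -
  have "\<exists>n. X \<inter> A n \<noteq> Y \<inter> A n"
    using assms by blast
  then show ?thesis
    using exists_least_iff[of "\<lambda>n. X \<inter> A n \<noteq> Y \<inter> A n"] by blast
qed

lemma INF_atMost_in_chain:
  fixes X :: "nat \<Rightarrow> 'a :: complete_lattice"
  assumes chain: "\<And>x y. \<lbrakk>x \<in> C; y \<in> C\<rbrakk> \<Longrightarrow> x \<le> y \<or> y \<le> x" and X: "\<And>m. X m \<in> C"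
  shows "(INF i\<in>{..m}. X i) \<in> C"
proof (induction m)
  case (Suc m)
  have "(INF i\<in>{..Suc m}. X i) = inf (X (Suc m)) (INF i\<in>{..m}. X i)"
    by (simp add: atMost_Suc)
  then show ?case
    using chain[OF X Suc.IH, of "Suc m"] X[of "Suc m"] Suc.IH
    by (auto simp: inf_absorb1 inf_absorb2)
qed (simp add: X)

lemma maximal_independent_set:
  assumes "symp_on X R" "reflp_on X R"
  obtains S where "S \<subseteq> X" "pairwise (\<lambda>x y. \<not> R x y) S" "\<And>x. x \<in> X \<Longrightarrow> \<exists>y\<in>S. R x y"
proof -
  define A where "A = {S. S \<subseteq> X \<and> pairwise (\<lambda>x y. \<not> R x y) S}"
  have "\<forall>C\<in>chains A. \<Union>C \<in> A"
    unfolding A_def chains_def by (auto intro: pairwise_chain_Union)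
  then obtain S where "S \<in> A" and maximal: "\<And>T. T \<in> A \<Longrightarrow> S \<subseteq> T \<Longrightarrow> T = S"
    using Zorn_Lemma[of A] by blast
  then have S: "S \<subseteq> X" "pairwise (\<lambda>x y. \<not> R x y) S"
    by (simp_all add: A_def)
  have "\<exists>y\<in>S. R x y" if x: "x \<in> X" for x
  proof (rule ccontr)
    assume none: "\<not> ?thesis"
    then have "\<not> R x y \<and> \<not> R y x" if "y \<in> S" for y
      using symp_onD[OF assms(1), of y x] S(1) x that by blast
    then have "insert x S \<in> A"
      using S x by (simp add: A_def pairwise_insert)
    then show False
      using maximal none reflp_onD[OF assms(2) x] by blast
  qed
  then show thesis
    using that S by blast
qed

lemma large_independent_set:
  assumes "symp_on X R" "reflp_on X R"
    and degree: "\<And>y. y \<in> X \<Longrightarrow> |{x \<in> X. R x y}| \<le>o |Q|"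
  obtains S where "S \<subseteq> X" "pairwise (\<lambda>x y. \<not> R x y) S" "|X| \<le>o |S \<times> Q|"
proof -
  obtain S where S: "S \<subseteq> X" "pairwise (\<lambda>x y. \<not> R x y) S" "\<And>x. x \<in> X \<Longrightarrow> \<exists>y\<in>S. R x y"
    using maximal_independent_set[OF assms(1,2)] by metis
  have "|X| \<le>o |\<Union>y\<in>S. {x \<in> X. R x y}|"
    using S(3) by (intro card_of_mono1) blast
  also have "|\<Union>y\<in>S. {x \<in> X. R x y}| \<le>o |SIGMA y:S. {x \<in> X. R x y}|"
    by (rule card_of_UNION_Sigma)
  also have "|SIGMA y:S. {x \<in> X. R x y}| \<le>o |S \<times> Q|"
    using degree S(1) by (intro card_of_Sigma_mono1) blast
  finally show thesis
    using that S(1,2) by blast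
qed

section \<open>Cosets and products of subgroups\<close>

context group
begin

lemma rcoset_eq_iff:
  assumes "subgroup L G" "x \<in> carrier G" "y \<in> carrier G"
  shows "L #> x = L #> y \<longleftrightarrow> x \<otimes> inv y \<in> L"
  using subgroup.rcos_module[OF assms(1) is_group assms(3,2)] rcos_self[OF assms(2,1)]
    repr_independence[OF _ assms(3,1)] by metis

lemma rcoset_eq_mono:
  assumes "subgroup L G" "subgroup L' G" "L \<subseteq> L'" "x \<in> carrier G" "y \<in> carrier G"
    and "L #> x = L #> y"
  shows "L' #> x = L' #> y"
  using assms rcoset_eq_iff by blast

lemma rcoset_mult_right_cancel:
  assumes "L \<subseteq> carrier G" "x \<in> carrier G" "y \<in> carrier G" "z \<in> carrier G"
  shows "L #> (x \<otimes> z) = L #> (y \<otimes> z) \<longleftrightarrow> L #> x = L #> y"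
proof
  assume "L #> (x \<otimes> z) = L #> (y \<otimes> z)"
  then have "(L #> (x \<otimes> z)) #> inv z = (L #> (y \<otimes> z)) #> inv z"
    by simp
  then show "L #> x = L #> y"
    using assms by (simp add: coset_mult_assoc m_assoc)
qed (metis assms coset_mult_assoc)

lemma rcosets_eq_image: "rcosets L = (#>) L ` carrier G"
  by (auto simp: RCOSETS_def)

lemma card_of_rcosets_ordLeq_image:
  assumes "\<And>x y. \<lbrakk>x \<in> carrier G; y \<in> carrier G; f x = f y\<rbrakk> \<Longrightarrow> L #> x = L #> y"
  shows "|rcosets L| \<le>o |f ` carrier G|"
proof -
  have "L #> x \<in> (\<lambda>z. L #> inv_into (carrier G) f z) ` f ` carrier G" if "x \<in> carrier G" for x
    using assms[of x "inv_into (carrier G) f (f x)"] that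
    by (metis f_inv_into_f image_eqI inv_into_into)
  then have "rcosets L \<subseteq> (\<lambda>z. L #> inv_into (carrier G) f z) ` f ` carrier G"
    by (auto simp: rcosets_eq_image)
  then show ?thesis
    by (rule surj_imp_ordLeq)
qed

lemma card_of_rcosets_antimono:
  assumes "subgroup L G" "subgroup L' G" "L \<subseteq> L'"
  shows "|rcosets L'| \<le>o |rcosets L|"
  unfolding rcosets_eq_image[of L]
  by (rule card_of_rcosets_ordLeq_image) (rule rcoset_eq_mono[OF assms])

lemma card_of_overgroups_ordLeq:
  assumes W: "subgroup W G"
  shows "|{V. subgroup V G \<and> W \<subseteq> V}| \<le>o |Pow (rcosets W)|"
proof (rule card_of_ordLeqI)
  have union: "V = (\<Union>x\<in>V. W #> x)" if V: "subgroup V G" "W \<subseteq> V" for V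
  proof
    show "V \<subseteq> (\<Union>x\<in>V. W #> x)"
      using rcos_self[OF _ W] subgroup.mem_carrier[OF V(1)] by blast
    show "(\<Union>x\<in>V. W #> x) \<subseteq> V"
      using V(2) subgroup.m_closed[OF V(1)] by (auto simp: r_coset_def)
  qed
  show "inj_on (\<lambda>V. (#>) W ` V) {V. subgroup V G \<and> W \<subseteq> V}"
  proof (rule inj_onI)
    fix V V'
    assume "V \<in> {V. subgroup V G \<and> W \<subseteq> V}" "V' \<in> {V. subgroup V G \<and> W \<subseteq> V}"
      and "(#>) W ` V = (#>) W ` V'"
    then show "V = V'"
      using union[of V] union[of V'] by simp
  qed
  show "(#>) W ` V \<in> Pow (rcosets W)" if "V \<in> {V. subgroup V G \<and> W \<subseteq> V}" for V
    using that subgroup.subset by (auto simp: rcosets_eq_image)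
qed

lemma card_of_rcosets_Inter_ordLeq:
  assumes D: "D \<noteq> {}" "\<And>V. V \<in> D \<Longrightarrow> subgroup V G"
  shows "|rcosets (\<Inter>D)| \<le>o |Pow (SIGMA V:D. rcosets V)|"
proof -
  define f where "f x = (SIGMA V:D. {V #> x})" for x
  have "|rcosets (\<Inter>D)| \<le>o |f ` carrier G|"
  proof (rule card_of_rcosets_ordLeq_image)
    fix x y assume xy: "x \<in> carrier G" "y \<in> carrier G" "f x = f y"
    have "V #> x = V #> y" if "V \<in> D" for V
      using xy(3) that unfolding f_def by blast
    then show "\<Inter>D #> x = \<Inter>D #> y"
      using xy rcoset_eq_iff[OF D(2)] rcoset_eq_iff[OF subgroups_Inter[OF D(2,1)]] by simp
  qed
  also have "|f ` carrier G| \<le>o |Pow (SIGMA V:D. rcosets V)|"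
    by (rule card_of_mono1) (auto simp: f_def rcosets_eq_image)
  finally show ?thesis .
qed

lemma card_of_rcosets_Inter_chain_ordLeq:
  assumes D: "D \<noteq> {}" "\<And>V. V \<in> D \<Longrightarrow> subgroup V G" "chain\<^sub>\<subseteq> D"
    and index: "\<And>V. V \<in> D \<Longrightarrow> |rcosets V| \<le>o |M|"
  shows "|rcosets (\<Inter>D)| \<le>o |Pow ((Pow (Pow M) \<times> Pow M) \<times> M)|"
proof -
  have "|D| \<le>o |Pow (Pow M) \<times> Pow M|"
  proof (rule card_of_chain_ordLeq[OF D(3)])
    fix W assume W: "W \<in> D"
    have "|{V \<in> D. W \<subseteq> V}| \<le>o |{V. subgroup V G \<and> W \<subseteq> V}|"
      using D(2) by (intro card_of_mono1) blast
    also have "|{V. subgroup V G \<and> W \<subseteq> V}| \<le>o |Pow (rcosets W)|"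
      by (rule card_of_overgroups_ordLeq[OF D(2)[OF W]])
    also have "|Pow (rcosets W)| \<le>o |Pow M|"
      by (rule card_of_Pow_mono[OF index[OF W]])
    finally show "|{V \<in> D. W \<subseteq> V}| \<le>o |Pow M|" .
  qed
  moreover have "|SIGMA V:D. rcosets V| \<le>o |D \<times> M|"
    using index by (intro card_of_Sigma_mono1) blast
  ultimately have "|SIGMA V:D. rcosets V| \<le>o |(Pow (Pow M) \<times> Pow M) \<times> M|"
    using card_of_Times_mono1 ordLeq_transitive by blast
  then show ?thesis
    using card_of_rcosets_Inter_ordLeq[OF D(1,2)] card_of_Pow_mono ordLeq_transitive by blast
qed

lemma set_multI: "a \<in> A \<Longrightarrow> b \<in> B \<Longrightarrow> a \<otimes> b \<in> A <#> B"
  by (auto simp: set_mult_def)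

lemma set_multE:
  assumes "x \<in> A <#> B"
  obtains a b where "a \<in> A" "b \<in> B" "x = a \<otimes> b"
  using assms by (auto simp: set_mult_def)

lemma card_of_rcosets_ordLeq_cover:
  assumes A: "subgroup A G" and P: "subgroup P G" and S: "S \<subseteq> carrier G" "P \<subseteq> A <#> S"
  shows "|rcosets A| \<le>o |S \<times> rcosets P|"
proof -
  define rep where "rep C = (SOME u. u \<in> C)" for C :: "'a set"
  have rep: "rep (P #> g) \<in> carrier G" "g \<otimes> inv (rep (P #> g)) \<in> P" if g: "g \<in> carrier G" for g
  proof -
    have rep_in: "rep (P #> g) \<in> P #> g"
      unfolding rep_def using rcos_self[OF g P] by (rule someI)
    then show rep_carrier: "rep (P #> g) \<in> carrier G"
      using subgroup.elemrcos_carrier[OF P is_group g] by blast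
    show "g \<otimes> inv (rep (P #> g)) \<in> P"
      using repr_independence[OF rep_in g P] rcoset_eq_iff[OF P g rep_carrier] by blast
  qed
  have "A #> g \<in> (\<lambda>(s, C). A #> (s \<otimes> rep C)) ` (S \<times> rcosets P)" if g: "g \<in> carrier G" for g
  proof -
    obtain a s where factors: "a \<in> A" "s \<in> S" "g \<otimes> inv (rep (P #> g)) = a \<otimes> s"
      using set_multE[OF subsetD[OF S(2) rep(2)[OF g]]] .
    have carrier: "a \<in> carrier G" "s \<in> carrier G"
      using factors S(1) subgroup.mem_carrier[OF A] by blast+
    have "g = a \<otimes> (s \<otimes> rep (P #> g))"
      using factors(3) carrier g rep(1)[OF g] by (metis inv_solve_right m_assoc m_closed)
    then have "A #> g = A #> (s \<otimes> rep (P #> g))"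
      using A factors(1) carrier rep(1)[OF g]
      by (metis coset_join2 coset_mult_assoc m_closed subgroup.subset)
    then show ?thesis
      using factors(2) g by (auto simp: rcosets_eq_image)
  qed
  then have "rcosets A \<subseteq> (\<lambda>(s, C). A #> (s \<otimes> rep C)) ` (S \<times> rcosets P)"
    by (auto simp only: rcosets_eq_image)
  then show ?thesis
    by (rule surj_imp_ordLeq)
qed

lemma mult_mem_set_mult_iff:
  assumes A: "subgroup A G" and b: "b \<in> A" and S: "S \<subseteq> carrier G" and x: "x \<in> carrier G"
  shows "b \<otimes> x \<in> A <#> S \<longleftrightarrow> x \<in> A <#> S"
proof -
  have mult: "d \<otimes> z \<in> A <#> S" if d: "d \<in> A" and z: "z \<in> A <#> S" for d z
  proof -
    obtain a s where factors: "a \<in> A" "s \<in> S" "z = a \<otimes> s"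
      using set_multE[OF z] .
    then have "d \<otimes> z = (d \<otimes> a) \<otimes> s"
      using d S subgroup.mem_carrier[OF A] by (simp add: m_assoc subset_iff)
    then show ?thesis
      using set_multI[OF subgroup.m_closed[OF A d factors(1)] factors(2)] by simp
  qed
  have "inv b \<otimes> (b \<otimes> x) = x"
    using x subgroup.mem_carrier[OF A b] by (simp add: m_assoc[symmetric])
  then show ?thesis
    using mult[OF b] mult[OF subgroup.m_inv_closed[OF A b], of "b \<otimes> x"] by auto
qed

text \<open>Right multiplication by \<open>inv s \<otimes> x\<close> moves the coset \<open>A #> s\<close> onto \<open>A #> x\<close>, which meets none
  of the cosets of \<open>A\<close> in the covering; so \<open>A\<close> can be dropped at the cost of translating the rest
  back.\<close>

lemma neumann_translate:
  assumes A: "subgroup A G" and P: "subgroup P G" and B: "B \<subseteq> carrier G" and S: "S \<subseteq> P"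
    and cover: "P \<subseteq> (A \<union> B) <#> S" and x: "x \<in> P" "x \<notin> A <#> S"
    and a: "a \<in> A" and s: "s \<in> S" and as: "a \<otimes> s \<in> P"
  shows "\<exists>b\<in>B. \<exists>r\<in>S. a \<otimes> s = b \<otimes> (r \<otimes> inv x \<otimes> s)"
proof -
  have S_carrier: "S \<subseteq> carrier G"
    using S subgroup.subset[OF P] by (rule subset_trans)
  have carrier: "a \<in> carrier G" "s \<in> carrier G" "x \<in> carrier G"
    using a s x(1) S_carrier subgroup.mem_carrier[OF A] subgroup.mem_carrier[OF P] by blast+
  have "a \<otimes> x = a \<otimes> s \<otimes> inv s \<otimes> x"
    using carrier by (simp add: m_assoc)
  also have "\<dots> \<in> P"
    using as s S x(1) P by (meson subgroup.m_closed subgroup.m_inv_closed subsetD)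
  finally have "a \<otimes> x \<in> P" .
  then obtain b r where br: "b \<in> A \<union> B" "r \<in> S" "a \<otimes> x = b \<otimes> r"
    using set_multE[OF subsetD[OF cover]] by blast
  have br_carrier: "b \<in> carrier G" "r \<in> carrier G"
    using br(1,2) B S_carrier subgroup.mem_carrier[OF A] by blast+
  have "a \<otimes> x \<notin> A <#> S"
    using x(2) mult_mem_set_mult_iff[OF A a S_carrier carrier(3)] by blast
  then have "b \<in> B"
    using br set_multI by auto
  have "b \<otimes> (r \<otimes> inv x \<otimes> s) = (b \<otimes> r) \<otimes> inv x \<otimes> s"
    using carrier br_carrier by (simp add: m_assoc)
  also have "\<dots> = a \<otimes> s"
    using carrier by (simp add: br(3)[symmetric] m_assoc)
  finally show ?thesis
    using \<open>b \<in> B\<close> br(2) by metis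
qed

lemma neumann_covering_step:
  assumes A: "subgroup A G" and P: "subgroup P G" and B: "B \<subseteq> carrier G" and S: "S \<subseteq> P"
    and cover: "P \<subseteq> (A \<union> B) <#> S" and x: "x \<in> P" "x \<notin> A <#> S"
  shows "P \<subseteq> B <#> (S \<union> (\<lambda>(r, s). r \<otimes> inv x \<otimes> s) ` (S \<times> S))"
proof
  fix y assume y: "y \<in> P"
  obtain a s where factors: "a \<in> A \<union> B" "s \<in> S" "y = a \<otimes> s"
    using set_multE[OF subsetD[OF cover y]] .
  show "y \<in> B <#> (S \<union> (\<lambda>(r, s). r \<otimes> inv x \<otimes> s) ` (S \<times> S))"
  proof (cases "a \<in> B")
    case True
    then show ?thesis
      using factors(2,3) by (auto intro: set_multI)
  next
    case False
    then obtain b r where "b \<in> B" "r \<in> S" "y = b \<otimes> (r \<otimes> inv x \<otimes> s)"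
      using neumann_translate[OF A P B S cover x _ factors(2)] factors y by blast
    moreover have "r \<otimes> inv x \<otimes> s \<in> (\<lambda>(r, s). r \<otimes> inv x \<otimes> s) ` (S \<times> S)"
      using \<open>r \<in> S\<close> factors(2) by (intro image_eqI[of _ _ "(r, s)"]) simp_all
    ultimately show ?thesis
      using set_multI by simp
  qed
qed

lemma neumann_covering:
  assumes A: "subgroup A G" and P: "subgroup P G" and B: "B \<subseteq> carrier G" and S: "S \<subseteq> P"
    and cover: "P \<subseteq> (A \<union> B) <#> S" and M: "|S| \<le>o |M|" "|M \<times> rcosets P| <o |rcosets A|"
  shows "\<exists>T\<subseteq>P. |T| \<le>o |M <+> M \<times> M| \<and> P \<subseteq> B <#> T"
proof -
  have "\<not> P \<subseteq> A <#> S"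
  proof
    assume "P \<subseteq> A <#> S"
    then have "|rcosets A| \<le>o |S \<times> rcosets P|"
      using S subgroup.subset[OF P] by (intro card_of_rcosets_ordLeq_cover A P) auto
    also have "|S \<times> rcosets P| \<le>o |M \<times> rcosets P|"
      using M(1) by (rule card_of_Times_mono1)
    finally show False
      using M(2) not_ordLess_ordLeq by blast
  qed
  then obtain x where x: "x \<in> P" "x \<notin> A <#> S"
    by blast
  define T where "T = S \<union> (\<lambda>(r, s). r \<otimes> inv x \<otimes> s) ` (S \<times> S)"
  have "P \<subseteq> B <#> T"
    unfolding T_def by (rule neumann_covering_step[OF A P B S cover x])
  moreover have "T \<subseteq> P"
    using S x(1) subgroup.m_closed[OF P] subgroup.m_inv_closed[OF P]
    by (auto simp: T_def subset_iff)
  moreover have "|T| \<le>o |M <+> M \<times> M|"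
    unfolding T_def by (rule card_of_Un_image_Times_ordLeq[OF M(1)])
  ultimately show ?thesis
    by blast
qed

definition normalizes :: "'a set \<Rightarrow> 'a set \<Rightarrow> bool" where
  "normalizes R V \<longleftrightarrow> (\<forall>k\<in>R. \<forall>v\<in>V. k \<otimes> v \<otimes> inv k \<in> V)"

lemma normalizesD: "\<lbrakk>normalizes R V; k \<in> R; v \<in> V\<rbrakk> \<Longrightarrow> k \<otimes> v \<otimes> inv k \<in> V"
  by (simp add: normalizes_def)

lemma normalizes_subset: "\<lbrakk>normalizes R V; A \<subseteq> R\<rbrakk> \<Longrightarrow> normalizes A V"
  by (auto simp: normalizes_def)

lemma normalizes_Inter: "(\<And>V. V \<in> D \<Longrightarrow> normalizes R V) \<Longrightarrow> normalizes R (\<Inter>D)"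
  by (auto simp: normalizes_def)

lemma normalizes_set_mult:
  assumes "R \<subseteq> carrier G" "A \<subseteq> carrier G" "B \<subseteq> carrier G" "normalizes R A" "normalizes R B"
  shows "normalizes R (A <#> B)"
  unfolding normalizes_def
proof (intro ballI)
  fix k v assume k: "k \<in> R" and v: "v \<in> A <#> B"
  obtain a b where factors: "a \<in> A" "b \<in> B" "v = a \<otimes> b"
    using set_multE[OF v] .
  have carrier: "k \<in> carrier G" "a \<in> carrier G" "b \<in> carrier G"
    using assms(1-3) k factors by blast+
  have "k \<otimes> v \<otimes> inv k = (k \<otimes> a) \<otimes> (inv k \<otimes> k) \<otimes> (b \<otimes> inv k)"
    using carrier by (simp add: factors(3) m_assoc)
  also have "\<dots> = (k \<otimes> a \<otimes> inv k) \<otimes> (k \<otimes> b \<otimes> inv k)"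
    using carrier by (simp only: m_assoc inv_closed m_closed)
  also have "\<dots> \<in> A <#> B"
    by (intro set_multI normalizesD[OF assms(4) k factors(1)] normalizesD[OF assms(5) k factors(2)])
  finally show "k \<otimes> v \<otimes> inv k \<in> A <#> B" .
qed

lemma set_mult_commute_if_normalizes:
  assumes A: "subgroup A G" and B: "B \<subseteq> carrier G" and AB: "normalizes A B"
  shows "A <#> B = B <#> A"
proof -
  have "a \<otimes> b \<in> B <#> A \<and> b \<otimes> a \<in> A <#> B" if factors: "a \<in> A" "b \<in> B" for a b
  proof -
    have carrier: "a \<in> carrier G" "b \<in> carrier G"
      using factors B subgroup.mem_carrier[OF A] by blast+
    have "a \<otimes> b = (a \<otimes> b \<otimes> inv a) \<otimes> a"
      using carrier by (simp add: m_assoc)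
    moreover have "b \<otimes> a = a \<otimes> (inv a \<otimes> b \<otimes> inv (inv a))"
      using carrier by (simp add: m_assoc[symmetric])
    moreover have "a \<otimes> b \<otimes> inv a \<in> B" and "inv a \<otimes> b \<otimes> inv (inv a) \<in> B"
      using normalizesD[OF AB] factors subgroup.m_inv_closed[OF A] by blast+
    ultimately show ?thesis
      using factors(1) set_multI by metis
  qed
  then show ?thesis
    by (auto elim: set_multE)
qed

lemma subgroup_set_mult:
  assumes A: "subgroup A G" and B: "subgroup B G" and AB: "normalizes A B"
  shows "subgroup (A <#> B) G"
proof (rule subgroupI)
  note carrier = subgroup.subset[OF A] subgroup.subset[OF B]
  have commute: "A <#> B = B <#> A"
    using set_mult_commute_if_normalizes[OF A carrier(2) AB] .
  show "A <#> B \<subseteq> carrier G"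
    using set_mult_closed[OF carrier] .
  show "A <#> B \<noteq> {}"
    using set_multI[OF subgroup.one_closed[OF A] subgroup.one_closed[OF B]] by blast
  show "inv x \<in> A <#> B" if x: "x \<in> A <#> B" for x
  proof -
    obtain a b where factors: "a \<in> A" "b \<in> B" "x = a \<otimes> b"
      using set_multE[OF x] .
    then have "inv x = inv b \<otimes> inv a"
      using carrier by (simp add: inv_mult_group subset_iff)
    then show ?thesis
      using factors subgroup.m_inv_closed[OF A] subgroup.m_inv_closed[OF B]
      unfolding commute by (auto intro: set_multI)
  qed
  have "(A <#> B) <#> (A <#> B) = A <#> ((B <#> A) <#> B)"
    using carrier by (simp add: set_mult_assoc set_mult_closed)
  also have "\<dots> = (A <#> A) <#> (B <#> B)"
    using carrier by (simp add: commute[symmetric] set_mult_assoc set_mult_closed)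
  also have "\<dots> = A <#> B"
    using A B by (simp add: subgroup_mult_id)
  finally show "x \<otimes> y \<in> A <#> B" if "x \<in> A <#> B" "y \<in> A <#> B" for x y
    using that set_multI by metis
qed

lemma subset_set_mult_left:
  assumes "A \<subseteq> carrier G" "subgroup B G"
  shows "A \<subseteq> A <#> B"
  using set_multI[OF _ subgroup.one_closed[OF assms(2)]] assms(1) by (metis r_one subset_iff)

lemma subset_set_mult_right:
  assumes "subgroup A G" "B \<subseteq> carrier G"
  shows "B \<subseteq> A <#> B"
  using set_multI[OF subgroup.one_closed[OF assms(1)]] assms(2) by (metis l_one subset_iff)

end

section \<open>Complete filtrations\<close>

context group
begin

definition filtration :: "(nat \<Rightarrow> 'a set) \<Rightarrow> bool" where
  "filtration V \<longleftrightarrow> (\<forall>n. subgroup (V n) G) \<and> antimono V"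

definition coherent :: "(nat \<Rightarrow> 'a set) \<Rightarrow> (nat \<Rightarrow> 'a) \<Rightarrow> bool" where
  "coherent V y \<longleftrightarrow> (\<forall>n. y n \<in> carrier G \<and> V n #> y (Suc n) = V n #> y n)"

definition coset_limit :: "(nat \<Rightarrow> 'a set) \<Rightarrow> (nat \<Rightarrow> 'a) \<Rightarrow> 'a \<Rightarrow> bool" where
  "coset_limit V y g \<longleftrightarrow> g \<in> carrier G \<and> (\<forall>n. V n #> g = V n #> y n)"

definition complete_filtration :: "(nat \<Rightarrow> 'a set) \<Rightarrow> bool" where
  "complete_filtration V \<longleftrightarrow> filtration V \<and> (\<forall>y. coherent V y \<longrightarrow> (\<exists>g. coset_limit V y g))"

lemma filtrationD:
  assumes "filtration V"
  shows "subgroup (V n) G" "m \<le> n \<Longrightarrow> V n \<subseteq> V m"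
  using assms by (simp_all add: filtration_def antimono_def)

lemma coherentD:
  assumes "coherent V y"
  shows "y n \<in> carrier G" "V n #> y (Suc n) = V n #> y n"
  using assms by (simp_all add: coherent_def)

lemma coset_limitD:
  assumes "coset_limit V y g"
  shows "g \<in> carrier G" "V n #> g = V n #> y n"
  using assms by (simp_all add: coset_limit_def)

lemma coherent_rcoset_eq:
  assumes V: "filtration V" and y: "coherent V y" and "m \<le> n"
  shows "V m #> y n = V m #> y m"
  using \<open>m \<le> n\<close>
proof (induction n rule: dec_induct)
  case (step n)
  have "V m #> y (Suc n) = V m #> y n"
    using rcoset_eq_mono[OF filtrationD(1,1)[OF V] filtrationD(2)[OF V step.hyps(1)]]
      coherentD[OF y] by blast
  then show ?case
    using step.IH by simp
qed simp

lemma coherent_coarser: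
  assumes V: "filtration V" and W: "filtration W" and "\<And>i. k \<le> i \<Longrightarrow> W i \<subseteq> V i"
    and y: "coherent W y"
  shows "coherent V (\<lambda>i. y (max i k))"
  unfolding coherent_def
proof
  fix i
  have "V i #> y (Suc i) = V i #> y i" if "k \<le> i"
    using rcoset_eq_mono[OF filtrationD(1)[OF W] filtrationD(1)[OF V] assms(3)[OF that]]
      coherentD[OF y] by blast
  then show "y (max i k) \<in> carrier G \<and> V i #> y (max (Suc i) k) = V i #> y (max i k)"
    using coherentD(1)[OF y] by (cases "k \<le> i") (auto simp: max_def not_less_eq_eq le_Suc_eq)
qed

primrec partial_prod :: "(nat \<Rightarrow> 'a) \<Rightarrow> nat \<Rightarrow> 'a" where
  "partial_prod a 0 = \<one>"
| "partial_prod a (Suc n) = a n \<otimes> partial_prod a n"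

lemma partial_prod_closed: "range a \<subseteq> carrier G \<Longrightarrow> partial_prod a n \<in> carrier G"
  by (induction n) (auto simp: image_subset_iff)

lemma partial_prod_cong: "(\<And>i. i < n \<Longrightarrow> a i = b i) \<Longrightarrow> partial_prod a n = partial_prod b n"
  by (induction n) simp_all

lemma coset_limit_partial_prod_exists:
  assumes V: "complete_filtration V" and a: "\<And>n. a n \<in> V n"
  shows "\<exists>g. coset_limit V (partial_prod a) g"
proof -
  have V_subgroup: "subgroup (V n) G" for n
    using V by (simp add: complete_filtration_def filtration_def)
  have a_carrier: "a n \<in> carrier G" for n
    using subgroup.mem_carrier[OF V_subgroup a] .
  then have carrier: "partial_prod a n \<in> carrier G" for n
    by (simp add: partial_prod_closed image_subset_iff)
  have "V n #> partial_prod a (Suc n) = V n #> partial_prod a n" for n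
    using a_carrier a carrier V_subgroup by (simp add: rcoset_eq_iff m_assoc)
  then show ?thesis
    using V carrier by (simp add: complete_filtration_def coherent_def)
qed

lemma coset_limit_partial_prod_rcoset_neq:
  assumes L: "subgroup L G" and V: "filtration V" "V (Suc n) \<subseteq> L"
    and a: "range a \<subseteq> carrier G" "coset_limit V (partial_prod a) g"
    and b: "range b \<subseteq> carrier G" "coset_limit V (partial_prod b) h"
    and eq: "\<And>i. i < n \<Longrightarrow> a i = b i" and neq: "L #> a n \<noteq> L #> b n"
  shows "L #> g \<noteq> L #> h"
proof -
  have limit: "L #> x = L #> (c n \<otimes> partial_prod c n)"
    if "range c \<subseteq> carrier G" "coset_limit V (partial_prod c) x" for c x
    using rcoset_eq_mono[OF filtrationD(1)[OF V(1)] L V(2) coset_limitD(1)[OF that(2)]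
        partial_prod_closed[OF that(1)] coset_limitD(2)[OF that(2)]] by simp
  have "partial_prod a n = partial_prod b n"
    by (rule partial_prod_cong[OF eq])
  then show ?thesis
    using limit[OF a] limit[OF b] neq a(1) b(1) partial_prod_closed[OF b(1), of n]
      rcoset_mult_right_cancel[OF subgroup.subset[OF L]]
    by (simp add: image_subset_iff)
qed

lemma ex_separated_limits:
  fixes a :: "'x \<Rightarrow> nat \<Rightarrow> 'a"
  assumes V: "complete_filtration V" and a: "\<And>x n. a x n \<in> V n"
  shows "\<exists>f. range f \<subseteq> carrier G \<and>
    (\<forall>x y n L. subgroup L G \<longrightarrow> V (Suc n) \<subseteq> L \<longrightarrow> (\<forall>i<n. a x i = a y i) \<longrightarrow>
      L #> a x n \<noteq> L #> a y n \<longrightarrow> L #> f x \<noteq> L #> f y)"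
proof -
  have V_filtration: "filtration V"
    using V by (simp add: complete_filtration_def)
  have carrier: "range (a x) \<subseteq> carrier G" for x
    using subgroup.mem_carrier[OF filtrationD(1)[OF V_filtration] a] by blast
  have "\<exists>g. coset_limit V (partial_prod (a x)) g" for x
    using V a by (rule coset_limit_partial_prod_exists)
  then obtain f where f: "\<And>x. coset_limit V (partial_prod (a x)) (f x)"
    by metis
  show ?thesis
    using coset_limitD(1)[OF f]
      coset_limit_partial_prod_rcoset_neq[OF _ V_filtration _ carrier f carrier f]
    by (intro exI[of _ f] conjI allI impI) auto
qed

end

locale filtered_group = group G
  for G :: "('a, 'm) monoid_scheme" (structure) and U :: "nat \<Rightarrow> 'a set" +
  assumes U_normal: "U n \<lhd> G"
    and U_complete: "complete_filtration U"
    and U_separated: "(\<Inter>n. U n) = {\<one>}"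
begin

lemma U_filtration: "filtration U"
  using U_complete by (simp add: complete_filtration_def)

lemmas U_subgroup = filtrationD(1)[OF U_filtration]

lemma U_conj: "\<lbrakk>x \<in> U n; g \<in> carrier G\<rbrakk> \<Longrightarrow> g \<otimes> x \<otimes> inv g \<in> U n"
  using normal.inv_op_closed2[OF U_normal] by blast

lemma U_rcoset_mult_left:
  assumes "g \<in> carrier G" "x \<in> U n"
  shows "U n #> (g \<otimes> x) = U n #> g"
  using assms U_conj subgroup.mem_carrier[OF U_subgroup] by (simp add: rcoset_eq_iff[OF U_subgroup])

lemma eq_if_U_rcosets_eq:
  assumes "g \<in> carrier G" "h \<in> carrier G" "\<And>n. U n #> g = U n #> h"
  shows "g = h"
proof -
  have "g \<otimes> inv h \<in> (\<Inter>n. U n)"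
    using assms rcoset_eq_iff[OF U_subgroup] by blast
  then show ?thesis
    using U_separated assms(1,2) by (metis inv_equality inv_closed inv_inv singletonD)
qed

definition complete_refinement :: "(nat \<Rightarrow> 'a set) \<Rightarrow> bool" where
  "complete_refinement V \<longleftrightarrow> complete_filtration V \<and> V \<le> U"

lemma complete_refinementD:
  assumes "complete_refinement V"
  shows "complete_filtration V" "filtration V" "V \<le> U"
  using assms by (simp_all add: complete_refinement_def complete_filtration_def)

lemma complete_refinement_U: "complete_refinement U"
  by (simp add: complete_refinement_def U_complete)

lemma refinement_limit_eq_U_limit:
  assumes V: "complete_refinement V" and W: "filtration W" "\<And>i. k \<le> i \<Longrightarrow> W i \<subseteq> V i" "W \<le> U"
    and y: "coherent W y" "coset_limit U y g" and "k \<le> n"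
  shows "V n #> g = V n #> y n"
proof -
  note V_filtration = complete_refinementD(2)[OF V]
  have "coherent V (\<lambda>i. y (max i k))"
    by (rule coherent_coarser[OF V_filtration W(1,2) y(1)])
  then obtain h where h: "coset_limit V (\<lambda>i. y (max i k)) h"
    using complete_refinementD(1)[OF V] by (auto simp: complete_filtration_def)
  have "h = g"
  proof (rule eq_if_U_rcosets_eq[OF coset_limitD(1)[OF h] coset_limitD(1)[OF y(2)]])
    fix n
    have "U n #> h = U n #> y (max n k)"
      using rcoset_eq_mono[OF filtrationD(1)[OF V_filtration] U_subgroup _ _ _
          coset_limitD(2)[OF h]]
        complete_refinementD(3)[OF V] coset_limitD(1)[OF h] coherentD(1)[OF y(1)]
      by (auto simp: le_fun_def)
    also have "\<dots> = U n #> y n"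
      using coherent_coarser[OF U_filtration W(1) _ y(1), of 0] W(3)
      by (intro coherent_rcoset_eq[OF U_filtration]) (simp_all add: le_fun_def)
    also have "\<dots> = U n #> g"
      using coset_limitD(2)[OF y(2)] by simp
    finally show "U n #> h = U n #> g" .
  qed
  then show ?thesis
    using coset_limitD(2)[OF h, of n] \<open>k \<le> n\<close> by (simp add: max_absorb1)
qed

lemma limit_rcoset_eq_if_open:
  assumes L: "subgroup L G" "V m \<subseteq> L" and V: "complete_refinement V"
    and W: "filtration W" "W \<le> U" and y: "coherent W y" "coset_limit U y g"
    and W_V: "\<forall>i\<ge>k. W i \<subseteq> V i" and W_L: "W n \<subseteq> L"
  shows "L #> g = L #> y n"
proof -
  define j where "j = n + m + k"
  note carrier = coset_limitD(1)[OF y(2)] coherentD(1)[OF y(1)]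
  note V_filtration = complete_refinementD(2)[OF V]
  have "V j \<subseteq> L"
    using filtrationD(2)[OF V_filtration, of m j] L(2) by (simp add: j_def)
  moreover have "V j #> g = V j #> y j"
    using V W y W_V by (intro refinement_limit_eq_U_limit[where k = k]) (simp_all add: j_def)
  ultimately have "L #> g = L #> y j"
    using rcoset_eq_mono[OF filtrationD(1)[OF V_filtration] L(1)] carrier by blast
  also have "W n #> y j = W n #> y n"
    by (rule coherent_rcoset_eq[OF W(1) y(1)]) (simp add: j_def)
  then have "L #> y j = L #> y n"
    by (rule rcoset_eq_mono[OF filtrationD(1)[OF W(1)] L(1) W_L carrier(2,2)])
  finally show ?thesis .
qed

text \<open>Subgroups containing a member of \<open>V\<close> are closed for the topology of \<open>V\<close>.\<close>

lemma complete_refinement_Inter: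
  assumes W: "filtration W" "W \<le> U" "\<And>n. W n = \<Inter>(\<B> n)"
    and \<B>: "\<And>n L. L \<in> \<B> n \<Longrightarrow> subgroup L G \<and>
      (\<exists>V k m. complete_refinement V \<and> (\<forall>i\<ge>k. W i \<subseteq> V i) \<and> V m \<subseteq> L)"
  shows "complete_refinement W"
proof -
  have "\<exists>g. coset_limit W y g" if y: "coherent W y" for y
  proof -
    have "coherent U y"
      using coherent_coarser[OF U_filtration W(1) _ y, of 0] W(2) by (simp add: le_fun_def)
    then obtain g where g: "coset_limit U y g"
      using U_complete by (auto simp: complete_filtration_def)
    note carrier = coset_limitD(1)[OF g] coherentD(1)[OF y]
    have "L #> g = L #> y n" if L: "L \<in> \<B> n" for L n
    proof -
      have "W n \<subseteq> L"
        using W(3) L by blast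
      then show ?thesis
        using \<B>[OF L] limit_rcoset_eq_if_open[OF _ _ _ W(1,2) y g] by blast
    qed
    then have "W n #> g = W n #> y n" for n
      using rcoset_eq_iff[OF filtrationD(1)[OF W(1)] carrier] rcoset_eq_iff[OF _ carrier] \<B>
      by (auto simp: W(3))
    then show ?thesis
      using carrier(1) by (auto simp: coset_limit_def)
  qed
  then show ?thesis
    using W(1,2) by (simp add: complete_refinement_def complete_filtration_def)
qed

lemma complete_refinement_Inf:
  assumes C: "C \<noteq> {}" "\<And>V. V \<in> C \<Longrightarrow> complete_refinement V"
  shows "complete_refinement (Inf C)"
proof (rule complete_refinement_Inter[where \<B> = "\<lambda>n. (\<lambda>V. V n) ` C"])
  have V_filtration: "filtration V" if "V \<in> C" for V
    by (rule complete_refinementD(2)[OF C(2)[OF that]])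
  show Inf_eq: "Inf C n = \<Inter>((\<lambda>V. V n) ` C)" for n
    by simp
  show "filtration (Inf C)"
    unfolding filtration_def
  proof (intro conjI allI antimonoI)
    show "subgroup (Inf C n) G" for n
      unfolding Inf_eq using C(1) filtrationD(1)[OF V_filtration] by (intro subgroups_Inter) auto
    show "Inf C n \<subseteq> Inf C m" if "m \<le> n" for m n
      unfolding Inf_eq using filtrationD(2)[OF V_filtration that] by blast
  qed
  show "Inf C \<le> U"
    using C complete_refinementD(3) by (metis Inf_lower2 ex_in_conv)
  fix n L assume "L \<in> (\<lambda>V. V n) ` C"
  then obtain V where V: "V \<in> C" "L = V n"
    by blast
  moreover have "Inf C i \<subseteq> V i" for i
    using V(1) by auto
  ultimately show "subgroup L G \<and>
      (\<exists>V k m. complete_refinement V \<and> (\<forall>i\<ge>k. Inf C i \<subseteq> V i) \<and> V m \<subseteq> L)"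
    using C(2) filtrationD(1)[OF V_filtration] by blast
qed

lemma complete_refinement_diagonal:
  assumes Y: "antimono Y" "\<And>m. complete_refinement (Y m)"
  shows "complete_refinement (\<lambda>m. Y m (max m n))"
proof (rule complete_refinement_Inter[where \<B> = "\<lambda>m. {Y m (max m n)}"])
  note Y_filtration = complete_refinementD(2)[OF Y(2)]
  have Y_mono: "Y j l \<subseteq> Y i k" if "i \<le> j" "k \<le> l" for i j k l
    using le_funD[OF antimonoD[OF Y(1) that(1)]] filtrationD(2)[OF Y_filtration that(2)]
    by (rule order_trans)
  show "filtration (\<lambda>m. Y m (max m n))"
    unfolding filtration_def
    by (intro conjI allI antimonoI filtrationD(1)[OF Y_filtration] Y_mono) auto
  show "(\<lambda>m. Y m (max m n)) \<le> U"
  proof (rule le_funI)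
    show "Y m (max m n) \<le> U m" for m
      using Y_mono[of m m m "max m n"] le_funD[OF complete_refinementD(3)[OF Y(2)], of m m] by auto
  qed
  fix m L assume "L \<in> {Y m (max m n)}"
  moreover have "Y i (max i n) \<subseteq> Y m i" if "m \<le> i" for i
    using that by (intro Y_mono) simp_all
  ultimately show "subgroup L G \<and>
      (\<exists>V k m. complete_refinement V \<and> (\<forall>i\<ge>k. Y i (max i n) \<subseteq> V i) \<and> V m \<subseteq> L)"
    using Y(2) filtrationD(1)[OF Y_filtration] by blast
qed simp

lemma complete_refinement_subseq:
  assumes V: "complete_refinement V" and d: "strict_mono d"
  shows "complete_refinement (V \<circ> d)"
proof (rule complete_refinement_Inter[where \<B> = "\<lambda>n. {V (d n)}"])
  note V_filtration = complete_refinementD(2)[OF V]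
  have subseq_le: "(V \<circ> d) i \<subseteq> V i" for i
    using filtrationD(2)[OF V_filtration strict_mono_imp_increasing[OF d]] by simp
  show "filtration (V \<circ> d)"
    unfolding filtration_def comp_def
    by (intro conjI allI antimonoI filtrationD[OF V_filtration] monoD[OF strict_mono_mono[OF d]])
  show "V \<circ> d \<le> U"
    using subseq_le le_funD[OF complete_refinementD(3)[OF V]] by (intro le_funI) (rule order_trans)
  fix n L assume "L \<in> {V (d n)}"
  then show "subgroup L G \<and>
      (\<exists>V' k m. complete_refinement V' \<and> (\<forall>i\<ge>k. (V \<circ> d) i \<subseteq> V' i) \<and> V' m \<subseteq> L)"
    using V filtrationD(1)[OF V_filtration] subseq_le by blast
qed simp

end

section \<open>Filtered homomorphisms\<close>

locale filtered_hom = filtered_group G U + H: filtered_group H N + \<sigma>: group_hom H G \<sigma>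
  for G :: "('a, 'm) monoid_scheme" (structure) and U :: "nat \<Rightarrow> 'a set"
    and H :: "('b, 'n) monoid_scheme" and N :: "nat \<Rightarrow> 'b set" and \<sigma> :: "'b \<Rightarrow> 'a" +
  assumes \<sigma>_filtered: "\<sigma> ` N n \<subseteq> U n"
begin

abbreviation K :: "nat \<Rightarrow> 'a set" where
  "K n \<equiv> \<sigma> ` N n"

lemma N_carrier: "N n \<subseteq> carrier H"
  using subgroup.subset[OF H.U_subgroup] .

lemma K_subgroup: "subgroup (K n) G"
  using \<sigma>.subgroup_img_is_subgroup[OF H.U_subgroup] .

lemma K_subset_range: "K n \<subseteq> \<sigma> ` carrier H"
  using N_carrier by (rule image_mono)

lemma range_subset: "\<sigma> ` carrier H \<subseteq> carrier G"
  using \<sigma>.hom_closed by blast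

lemma normalizes_range_K: "normalizes (\<sigma> ` carrier H) (K n)"
proof -
  have "\<sigma> g \<otimes> \<sigma> h \<otimes> inv \<sigma> g \<in> K n" if "g \<in> carrier H" "h \<in> N n" for g h
  proof -
    have "\<sigma> (g \<otimes>\<^bsub>H\<^esub> h \<otimes>\<^bsub>H\<^esub> inv\<^bsub>H\<^esub> g) \<in> K n"
      using H.U_conj[OF that(2,1)] by blast
    then show ?thesis
      using that N_carrier by (simp add: subset_iff)
  qed
  then show ?thesis
    by (auto simp: normalizes_def)
qed

definition adapted :: "(nat \<Rightarrow> 'a set) \<Rightarrow> bool" where
  "adapted V \<longleftrightarrow>
     complete_refinement V \<and> (\<forall>n. K n \<subseteq> V n \<and> normalizes (\<sigma> ` carrier H) (V n))"

lemma adaptedD: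
  assumes "adapted V"
  shows "complete_refinement V" "filtration V" "V \<le> U" "subgroup (V n) G" "V n \<subseteq> carrier G"
    "K n \<subseteq> V n" "normalizes (\<sigma> ` carrier H) (V n)"
proof -
  show V: "complete_refinement V" "K n \<subseteq> V n" "normalizes (\<sigma> ` carrier H) (V n)"
    using assms by (simp_all add: adapted_def)
  then show "filtration V" "V \<le> U"
    by (simp_all add: complete_refinementD)
  then show "subgroup (V n) G" "V n \<subseteq> carrier G"
    by (simp_all add: filtrationD(1) subgroup.subset)
qed

lemma adapted_U: "adapted U"
proof -
  have "normalizes (\<sigma> ` carrier H) (U n)" for n
    unfolding normalizes_def using U_conj range_subset by blast
  then show ?thesis
    using complete_refinement_U \<sigma>_filtered by (simp add: adapted_def)
qed

lemma adapted_Inf: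
  assumes "C \<noteq> {}" "\<And>V. V \<in> C \<Longrightarrow> adapted V"
  shows "adapted (Inf C)"
proof -
  have "complete_refinement (Inf C)"
    by (rule complete_refinement_Inf[OF assms(1) adaptedD(1)[OF assms(2)]])
  moreover have "normalizes (\<sigma> ` carrier H) (Inf C n)" for n
    unfolding Inf_apply using assms(2) adaptedD(7) by (intro normalizes_Inter) blast
  moreover have "K n \<subseteq> Inf C n" for n
    using assms(2) adaptedD(6) by (simp add: INF_greatest)
  ultimately show ?thesis
    by (simp add: adapted_def)
qed

definition image_closure :: "(nat \<Rightarrow> 'a set) \<Rightarrow> nat \<Rightarrow> 'a set" where
  "image_closure V n = \<Inter>(range (\<lambda>m. K n <#> V m))"

lemma subgroup_K_mult:
  assumes "adapted V"
  shows "subgroup (K n <#> V m) G"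
  by (rule subgroup_set_mult[OF K_subgroup adaptedD(4)[OF assms]
        normalizes_subset[OF adaptedD(7)[OF assms] K_subset_range]])

lemma K_subset_K_mult: "adapted V \<Longrightarrow> K n \<subseteq> K n <#> V m"
  by (rule subset_set_mult_left[OF subgroup.subset[OF K_subgroup] adaptedD(4)])

lemma subset_K_mult: "adapted V \<Longrightarrow> V m \<subseteq> K n <#> V m"
  by (rule subset_set_mult_right[OF K_subgroup adaptedD(5)])

lemma image_closure_le:
  assumes V: "adapted V"
  shows "image_closure V \<le> V"
proof (rule le_funI)
  fix n
  have "K n <#> V n \<subseteq> V n <#> V n"
    using adaptedD(6)[OF V] by (intro mono_set_mult) simp_all
  also have "\<dots> = V n"
    by (rule subgroup_mult_id[OF adaptedD(4)[OF V]])
  finally show "image_closure V n \<subseteq> V n"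
    by (auto simp: image_closure_def)
qed

lemma adapted_image_closure:
  assumes V: "adapted V"
  shows "adapted (image_closure V)"
proof -
  have "filtration (image_closure V)"
    unfolding filtration_def
  proof (intro conjI allI antimonoI)
    show "subgroup (image_closure V n) G" for n
      unfolding image_closure_def using subgroup_K_mult[OF V] by (intro subgroups_Inter) auto
    show "image_closure V n \<subseteq> image_closure V m" if "m \<le> n" for m n
      unfolding image_closure_def
      by (intro INF_mono' mono_set_mult image_mono H.filtrationD(2)[OF H.U_filtration that])
        simp_all
  qed
  moreover have "image_closure V \<le> U"
    using image_closure_le[OF V] adaptedD(3)[OF V] by (rule order_trans)
  ultimately have "complete_refinement (image_closure V)"
  proof (rule complete_refinement_Inter[OF _ _ image_closure_def])
    fix n L assume "L \<in> range (\<lambda>m. K n <#> V m)"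
    then obtain m where "L = K n <#> V m"
      by blast
    then show "subgroup L G \<and>
        (\<exists>V' k m. complete_refinement V' \<and> (\<forall>i\<ge>k. image_closure V i \<subseteq> V' i) \<and> V' m \<subseteq> L)"
      using subgroup_K_mult[OF V] adaptedD(1)[OF V] le_funD[OF image_closure_le[OF V]]
        subset_K_mult[OF V] by blast
  qed
  moreover have "normalizes (\<sigma> ` carrier H) (K n <#> V m)" for n m
    using range_subset subgroup.subset[OF K_subgroup] adaptedD(5)[OF V] normalizes_range_K
      adaptedD(7)[OF V] by (rule normalizes_set_mult)
  then have "normalizes (\<sigma> ` carrier H) (image_closure V n)" for n
    unfolding image_closure_def by (intro normalizes_Inter) blast
  moreover have "K n \<subseteq> image_closure V n" for n
    using K_subset_K_mult[OF V] by (auto simp: image_closure_def)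
  ultimately show ?thesis
    by (simp add: adapted_def)
qed

lemma successive_approximation:
  assumes V: "adapted V" "image_closure V = V" and g: "g \<in> V 0"
  shows "\<exists>p. H.coherent N p \<and> (\<forall>n. inv (\<sigma> (p n)) \<otimes> g \<in> V n)"
proof -
  note V_carrier = subsetD[OF adaptedD(5)[OF V(1)]]
  let ?approximates = "\<lambda>n p. p \<in> carrier H \<and> inv (\<sigma> p) \<otimes> g \<in> V n"
  have "\<exists>p. \<forall>n. ?approximates n (p n) \<and> N n #>\<^bsub>H\<^esub> p (Suc n) = N n #>\<^bsub>H\<^esub> p n"
  proof (rule dependent_nat_choice)
    show "\<exists>p. ?approximates 0 p"
      using g V_carrier[OF g] by (intro exI[of _ "\<one>\<^bsub>H\<^esub>"]) simp
    fix p n assume p: "?approximates n p"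
    then have "inv (\<sigma> p) \<otimes> g \<in> image_closure V n"
      using V(2) by simp
    then have "inv (\<sigma> p) \<otimes> g \<in> K n <#> V (Suc n)"
      by (auto simp: image_closure_def)
    then obtain h r where h: "h \<in> N n" "r \<in> V (Suc n)" "inv (\<sigma> p) \<otimes> g = \<sigma> h \<otimes> r"
      by (auto elim: set_multE)
    have h_carrier: "h \<in> carrier H"
      using h(1) N_carrier by blast
    have "inv (\<sigma> (p \<otimes>\<^bsub>H\<^esub> h)) \<otimes> g = inv (\<sigma> h) \<otimes> (inv (\<sigma> p) \<otimes> g)"
      using p h_carrier V_carrier[OF g] by (simp add: inv_mult_group m_assoc)
    also have "\<dots> = r"
      using h_carrier V_carrier[OF h(2)] by (simp add: h(3) m_assoc[symmetric])
    finally show "\<exists>q. ?approximates (Suc n) q \<and> N n #>\<^bsub>H\<^esub> q = N n #>\<^bsub>H\<^esub> p"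
      using p h(1,2) h_carrier H.U_rcoset_mult_left by (intro exI[of _ "p \<otimes>\<^bsub>H\<^esub> h"]) simp
  qed
  then show ?thesis
    by (auto simp: H.coherent_def)
qed

lemma fixed_by_image_closure_subset_range:
  assumes V: "adapted V" "image_closure V = V"
  shows "V 0 \<subseteq> \<sigma> ` carrier H"
proof
  fix g assume g: "g \<in> V 0"
  have g_carrier: "g \<in> carrier G"
    using subsetD[OF adaptedD(5)[OF V(1)] g] .
  obtain p where p: "H.coherent N p" "\<And>n. inv (\<sigma> (p n)) \<otimes> g \<in> V n"
    using successive_approximation[OF V g] by blast
  obtain q where q: "H.coset_limit N p q"
    using H.U_complete p(1) by (auto simp: H.complete_filtration_def)
  note p_carrier = H.coherentD(1)[OF p(1)] and q_carrier = H.coset_limitD(1)[OF q]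
  have "g = \<sigma> q"
  proof (rule eq_if_U_rcosets_eq[OF g_carrier \<sigma>.hom_closed[OF q_carrier]])
    fix n
    have "inv (\<sigma> (p n)) \<otimes> g \<in> U n"
      using p(2) le_funD[OF adaptedD(3)[OF V(1)]] by blast
    then have "U n #> (\<sigma> (p n) \<otimes> (inv (\<sigma> (p n)) \<otimes> g)) = U n #> \<sigma> (p n)"
      using p_carrier by (intro U_rcoset_mult_left) simp
    then have "U n #> g = U n #> \<sigma> (p n)"
      using p_carrier g_carrier by (simp add: m_assoc[symmetric])
    moreover have "q \<otimes>\<^bsub>H\<^esub> inv\<^bsub>H\<^esub> p n \<in> N n"
      using H.coset_limitD(2)[OF q] H.rcoset_eq_iff[OF H.U_subgroup q_carrier p_carrier] by blast
    then have "\<sigma> (q \<otimes>\<^bsub>H\<^esub> inv\<^bsub>H\<^esub> p n) \<in> U n"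
      using \<sigma>_filtered by blast
    then have "U n #> \<sigma> q = U n #> \<sigma> (p n)"
      using q_carrier p_carrier by (simp add: rcoset_eq_iff[OF U_subgroup])
    ultimately show "U n #> g = U n #> \<sigma> q"
      by simp
  qed
  then show "g \<in> \<sigma> ` carrier H"
    using q_carrier by blast
qed

end

section \<open>Filtrations of unbounded index\<close>

definition (in group) incongruent :: "'i set \<Rightarrow> ('i \<Rightarrow> 'a set) \<Rightarrow> 'a set \<Rightarrow> bool" where
  "incongruent I L S \<longleftrightarrow> pairwise (\<lambda>x y. \<forall>t\<in>I. L t #> x \<noteq> L t #> y) S"

locale strong_limit_group = group G + strong_limit_omega lam
  for G :: "('a, 'm) monoid_scheme" (structure) and lam :: "'k rel"
begin

definition unbounded_filtration :: "(nat \<Rightarrow> 'a set) \<Rightarrow> bool" where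
  "unbounded_filtration L \<longleftrightarrow>
     filtration L \<and> (\<forall>M :: 'k set. |M| <o lam \<longrightarrow> (\<exists>m. |M| <o |rcosets (L m)| ))"

definition uncoverable :: "'a set \<Rightarrow> (nat \<Rightarrow> 'a set) \<Rightarrow> bool" where
  "uncoverable P B \<longleftrightarrow>
     (\<forall>M :: 'k set. |M| <o lam \<longrightarrow> (\<exists>m. \<forall>S\<subseteq>P. |S| \<le>o |M| \<longrightarrow> \<not> P \<subseteq> B m <#> S))"

lemma large_index_if_incongruent_families:
  assumes K: "subgroup K G"
    and families: "\<And>M :: 'k set. |M| <o lam \<Longrightarrow>
      \<exists>f\<in>M \<rightarrow> carrier G. \<forall>i\<in>M. \<forall>j\<in>M. i \<noteq> j \<longrightarrow> f i \<otimes> inv (f j) \<notin> K"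
  shows "lam \<le>o |rcosets K|"
proof (rule ccontr)
  assume "\<not> ?thesis"
  then have "|rcosets K| <o lam"
    using not_small_iff by blast
  then obtain M :: "'k set" where M: "|Pow (rcosets K)| =o |M|" "|M| <o lam"
    using small_copy[OF small_Pow] by blast
  obtain f where f: "f \<in> M \<rightarrow> carrier G" "\<forall>i\<in>M. \<forall>j\<in>M. i \<noteq> j \<longrightarrow> f i \<otimes> inv (f j) \<notin> K"
    using families[OF M(2)] by blast
  have "inj_on (\<lambda>i. K #> f i) M"
    using f rcoset_eq_iff[OF K] by (intro inj_onI) blast
  then have "|M| \<le>o |rcosets K|"
    using f(1) by (intro card_of_ordLeqI) (auto simp: rcosets_eq_image)
  then have "|Pow (rcosets K)| \<le>o |rcosets K|"
    using M(1) ordIso_ordLeq_trans by blast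
  then show False
    using card_of_Pow not_ordLess_ordLeq by blast
qed

lemma index_unbounded_on_chain:
  fixes M :: "'k set"
  assumes D: "D \<noteq> {}" "\<And>V. V \<in> D \<Longrightarrow> subgroup V G" "chain\<^sub>\<subseteq> D"
    and large: "\<not> |rcosets (\<Inter>D)| <o lam" and M: "|M| <o lam"
  shows "\<exists>V\<in>D. |M| <o |rcosets V|"
proof (rule ccontr)
  assume "\<not> ?thesis"
  then have "|rcosets V| \<le>o |M|" if "V \<in> D" for V
    using that not_ordLess_iff_ordLeq[OF card_of_Well_order card_of_Well_order] by blast
  then have "|rcosets (\<Inter>D)| \<le>o |Pow ((Pow (Pow M) \<times> Pow M) \<times> M)|"
    by (intro card_of_rcosets_Inter_chain_ordLeq[OF D])
  moreover have "|Pow ((Pow (Pow M) \<times> Pow M) \<times> M)| <o lam"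
    using M by (intro small_Pow small_Times)
  ultimately show False
    using large small_mono by blast
qed

lemma unbounded_filtrationD:
  fixes M :: "'k set"
  assumes "unbounded_filtration L"
  shows "filtration L" "|M| <o lam \<Longrightarrow> \<exists>m. |M| <o |rcosets (L m)|"
  using assms by (simp_all add: unbounded_filtration_def)

lemma unbounded_filtrationI:
  assumes L: "filtration L" and large: "\<not> |rcosets (\<Inter>(range L))| <o lam"
  shows "unbounded_filtration L"
  unfolding unbounded_filtration_def
proof (intro conjI allI impI)
  fix M :: "'k set" assume M: "|M| <o lam"
  have "chain\<^sub>\<subseteq> (range L)"
    using filtrationD(2)[OF L] nat_le_linear unfolding chain_subset_def by blast
  then show "\<exists>m. |M| <o |rcosets (L m)|"
    using index_unbounded_on_chain[OF _ _ _ large M] filtrationD(1)[OF L] by blast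
qed (fact L)

lemma uncoverableD:
  fixes M :: "'k set"
  assumes "uncoverable P B" "|M| <o lam"
  shows "\<exists>m. \<forall>S\<subseteq>P. |S| \<le>o |M| \<longrightarrow> \<not> P \<subseteq> B m <#> S"
  using assms by (simp add: uncoverable_def)

lemma uncoverable_Un:
  assumes P: "subgroup P G" "|rcosets P| <o lam" and A: "unbounded_filtration A"
    and B: "antimono B" "\<And>m. B m \<subseteq> carrier G" "uncoverable P B"
  shows "uncoverable P (\<lambda>m. A m \<union> B m)"
  unfolding uncoverable_def
proof (intro allI impI)
  fix M :: "'k set" assume M: "|M| <o lam"
  obtain M\<^sub>A :: "'k set" where M\<^sub>A: "|M \<times> rcosets P| =o |M\<^sub>A|" "|M\<^sub>A| <o lam"
    using small_copy[OF small_Times[OF M P(2)]] .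
  obtain M\<^sub>B :: "'k set" where M\<^sub>B: "|M <+> M \<times> M| =o |M\<^sub>B|" "|M\<^sub>B| <o lam"
    using small_copy[OF small_Plus[OF M small_Times[OF M M]]] .
  obtain a where a: "|M\<^sub>A| <o |rcosets (A a)|"
    using unbounded_filtrationD(2)[OF A M\<^sub>A(2)] by blast
  obtain b where b: "\<And>S. S \<subseteq> P \<Longrightarrow> |S| \<le>o |M\<^sub>B| \<Longrightarrow> \<not> P \<subseteq> B b <#> S"
    using uncoverableD[OF B(3) M\<^sub>B(2)] by blast
  note A_filtration = unbounded_filtrationD(1)[OF A]
  define m where "m = max a b"
  have "|rcosets (A a)| \<le>o |rcosets (A m)|"
    using filtrationD[OF A_filtration] by (intro card_of_rcosets_antimono) (simp_all add: m_def)
  then have index: "|M \<times> rcosets P| <o |rcosets (A m)|"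
    using ordLess_ordLeq_trans[OF ordIso_ordLess_trans[OF M\<^sub>A(1) a]] by blast
  have "\<not> P \<subseteq> (A m \<union> B m) <#> S" if S: "S \<subseteq> P" "|S| \<le>o |M|" for S
  proof
    assume "P \<subseteq> (A m \<union> B m) <#> S"
    then obtain T where T: "T \<subseteq> P" "|T| \<le>o |M <+> M \<times> M|" "P \<subseteq> B m <#> T"
      using neumann_covering[OF filtrationD(1)[OF A_filtration] P(1) B(2) S(1) _ S(2) index]
      by blast
    have "B m <#> T \<subseteq> B b <#> T"
      by (intro mono_set_mult antimonoD[OF B(1)]) (simp_all add: m_def)
    then show False
      using b[OF T(1) ordLeq_ordIso_trans[OF T(2) M\<^sub>B(1)]] T(3) by blast
  qed
  then show "\<exists>m. \<forall>S\<subseteq>P. |S| \<le>o |M| \<longrightarrow> \<not> P \<subseteq> (A m \<union> B m) <#> S"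
    by blast
qed

lemma uncoverable_UN:
  assumes P: "subgroup P G" "|rcosets P| <o lam"
    and "finite J" "\<forall>t\<in>J. unbounded_filtration (L t)"
  shows "uncoverable P (\<lambda>m. \<Union>t\<in>J. L t m)"
  using assms(3,4)
proof (induction J rule: finite_induct)
  case empty
  then show ?case
    using subgroup.one_closed[OF P(1)] by (auto simp: uncoverable_def set_mult_def)
next
  case (insert a J)
  have L_filtration: "filtration (L t)" if "t \<in> J" for t
    using unbounded_filtrationD(1) insert.prems that by blast
  have "uncoverable P (\<lambda>m. L a m \<union> (\<Union>t\<in>J. L t m))"
  proof (rule uncoverable_Un[OF P])
    show "antimono (\<lambda>m. \<Union>t\<in>J. L t m)"
      using filtrationD(2)[OF L_filtration] by (intro antimonoI UN_mono) auto
    show "(\<Union>t\<in>J. L t m) \<subseteq> carrier G" for m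
      using subgroup.subset[OF filtrationD(1)[OF L_filtration]] by blast
  qed (use insert in auto)
  then show ?case
    by simp
qed

lemma ex_incongruent_subset:
  assumes P: "subgroup P G" "|rcosets P| <o lam" and I: "finite I" "I \<noteq> {}"
    and L: "\<forall>t\<in>I. unbounded_filtration (L t)" and X: "|X| <o lam"
  shows "\<exists>m>k. \<exists>S\<subseteq>P. |X| \<le>o |S| \<and> incongruent I (\<lambda>t. L t m) S"
proof -
  obtain M :: "'k set" where M: "|X| =o |M|" "|M| <o lam"
    using small_copy[OF X] .
  obtain n where n: "\<And>S. S \<subseteq> P \<Longrightarrow> |S| \<le>o |M| \<Longrightarrow> \<not> P \<subseteq> (\<Union>t\<in>I. L t n) <#> S"
    using uncoverableD[OF uncoverable_UN[OF P I(1) L] M(2)] by blast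
  define m where "m = max n (Suc k)"
  have L_filtration: "filtration (L t)" if "t \<in> I" for t
    using unbounded_filtrationD(1) L that by blast
  have L_subset: "L t m \<subseteq> L t n" if "t \<in> I" for t
    using filtrationD(2)[OF L_filtration[OF that]] by (simp add: m_def)
  define R where "R x y \<longleftrightarrow> (\<exists>t\<in>I. L t m #> x = L t m #> y)" for x y
  have "symp_on P R" "reflp_on P R"
    using I(2) unfolding R_def symp_on_def reflp_on_def by (metis, blast)
  then obtain S where S: "S \<subseteq> P" "pairwise (\<lambda>x y. \<not> R x y) S" "\<And>x. x \<in> P \<Longrightarrow> \<exists>y\<in>S. R x y"
    using maximal_independent_set by metis
  have "P \<subseteq> (\<Union>t\<in>I. L t n) <#> S"
  proof
    fix x assume x: "x \<in> P"
    then obtain t y where witness: "t \<in> I" "y \<in> S" "L t m #> x = L t m #> y"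
      using S(3) unfolding R_def by blast
    have "x \<in> L t m #> y"
      using witness(3) rcos_self[OF subgroup.mem_carrier[OF P(1) x]]
        filtrationD(1)[OF L_filtration[OF witness(1)]] by metis
    then show "x \<in> (\<Union>t\<in>I. L t n) <#> S"
      using witness(1,2) L_subset by (auto simp: r_coset_def set_mult_def)
  qed
  then have "\<not> |S| \<le>o |M|"
    using n[OF S(1)] by blast
  then have "|X| \<le>o |S|"
    using M(1) ordLeq_total[OF card_of_Well_order card_of_Well_order] ordIso_ordLeq_trans by blast
  moreover have "incongruent I (\<lambda>t. L t m) S"
    using S(2) by (simp add: incongruent_def R_def)
  ultimately show ?thesis
    using S(1) by (intro exI[of _ m]) (auto simp: m_def)
qed

end

section \<open>Separating towers\<close>

locale small_filtered_group = filtered_group G U + strong_limit_group G lam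
  for G :: "('a, 'm) monoid_scheme" (structure) and U :: "nat \<Rightarrow> 'a set" and lam :: "'k rel" +
  assumes U_small: "|rcosets (U n)| <o lam"
begin

definition small_refinement :: "(nat \<Rightarrow> 'a set) \<Rightarrow> bool" where
  "small_refinement V \<longleftrightarrow> complete_refinement V \<and> (\<forall>n. |rcosets (V n)| <o lam)"

definition separating_tower :: "(nat \<Rightarrow> 'a set) \<Rightarrow> (nat \<Rightarrow> 'a set) \<Rightarrow> 'a set \<Rightarrow> bool" where
  "separating_tower W L Z \<longleftrightarrow>
     small_refinement W \<and> unbounded_filtration L \<and> W \<le> L \<and> (\<forall>m. Z \<subseteq> L m)"

lemma small_refinementD:
  assumes "small_refinement V"
  shows "complete_refinement V" "filtration V" "|rcosets (V n)| <o lam"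
  using assms by (simp_all add: small_refinement_def complete_refinementD)

lemma small_refinement_Inf:
  assumes C: "finite C" "C \<noteq> {}" "\<And>V. V \<in> C \<Longrightarrow> small_refinement V"
  shows "small_refinement (Inf C)"
  unfolding small_refinement_def
proof (intro conjI allI)
  show "complete_refinement (Inf C)"
    using small_refinementD(1)[OF C(3)] by (rule complete_refinement_Inf[OF C(2)])
  fix n
  let ?D = "(\<lambda>V. V n) ` C"
  have "|rcosets (\<Inter>?D)| \<le>o |Pow (SIGMA B:?D. rcosets B)|"
    using C(2) filtrationD(1)[OF small_refinementD(2)[OF C(3)]]
    by (intro card_of_rcosets_Inter_ordLeq) auto
  moreover have "|Pow (SIGMA B:?D. rcosets B)| <o lam"
    using C(1) small_refinementD(3)[OF C(3)] by (intro small_Pow small_Sigma_finite) auto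
  ultimately show "|rcosets (Inf C n)| <o lam"
    unfolding Inf_apply by (rule small_mono)
qed

end

locale small_filtered_hom = filtered_hom G U H N \<sigma> + small_filtered_group G U lam
  for G :: "('a, 'm) monoid_scheme" (structure) and U :: "nat \<Rightarrow> 'a set" and lam :: "'k rel"
    and H :: "('b, 'n) monoid_scheme" and N :: "nat \<Rightarrow> 'b set" and \<sigma> :: "'b \<Rightarrow> 'a"
begin

definition small_adapted :: "(nat \<Rightarrow> 'a set) \<Rightarrow> bool" where
  "small_adapted V \<longleftrightarrow> adapted V \<and> (\<forall>n. |rcosets (V n)| <o lam)"

lemma small_adaptedD:
  assumes "small_adapted V"
  shows "adapted V" "complete_refinement V" "filtration V" "|rcosets (V n)| <o lam"
  using assms by (simp_all add: small_adapted_def adaptedD)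

lemma separating_tower_image_closure:
  assumes V: "small_adapted V" and large: "\<not> |rcosets (image_closure V n)| <o lam"
  shows "separating_tower V (\<lambda>m. K n <#> V m) (K n)"
proof -
  note V_adapted = small_adaptedD(1)[OF V]
  have "filtration (\<lambda>m. K n <#> V m)"
    unfolding filtration_def
    by (intro conjI allI antimonoI subgroup_K_mult[OF V_adapted] mono_set_mult order_refl
        filtrationD(2)[OF small_adaptedD(3)[OF V]])
  then have "unbounded_filtration (\<lambda>m. K n <#> V m)"
    using unbounded_filtrationI large by (simp add: image_closure_def)
  then show ?thesis
    using small_adaptedD[OF V] K_subset_K_mult[OF V_adapted] subset_K_mult[OF V_adapted]
    by (simp add: separating_tower_def small_refinement_def le_fun_def)
qed

lemma index_unbounded_on_small_adapted_chain:
  fixes M :: "'k set"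
  assumes C: "C \<noteq> {}" "\<And>V. V \<in> C \<Longrightarrow> small_adapted V"
    and chain: "\<And>V W. V \<in> C \<Longrightarrow> W \<in> C \<Longrightarrow> V \<le> W \<or> W \<le> V"
    and large: "\<not> |rcosets (Inf C n)| <o lam" and M: "|M| <o lam"
  shows "\<exists>V\<in>C. |M| <o |rcosets (V n)|"
proof -
  have "chain\<^sub>\<subseteq> ((\<lambda>V. V n) ` C)"
    using chain unfolding chain_subset_def le_fun_def by blast
  then have "\<exists>B\<in>(\<lambda>V. V n) ` C. |M| <o |rcosets B|"
    using C adaptedD(4)[OF small_adaptedD(1)] large M
    by (intro index_unbounded_on_chain) auto
  then show ?thesis
    by blast
qed

lemma descending_sequence_of_unbounded_index:
  fixes A :: "nat \<Rightarrow> 'k set"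
  assumes C: "C \<noteq> {}" "\<And>V. V \<in> C \<Longrightarrow> small_adapted V"
    and chain: "\<And>V W. V \<in> C \<Longrightarrow> W \<in> C \<Longrightarrow> V \<le> W \<or> W \<le> V"
    and large: "\<not> |rcosets (Inf C n)| <o lam" and A: "\<And>m. |A m| <o lam"
  shows "\<exists>Y. antimono Y \<and> (\<forall>m. Y m \<in> C \<and> |A m| <o |rcosets (Y m n)| )"
proof -
  have "\<exists>V\<in>C. |A m| <o |rcosets (V n)|" for m
    by (rule index_unbounded_on_small_adapted_chain[OF C chain large A])
  then obtain X where X: "\<And>m. X m \<in> C" "\<And>m. |A m| <o |rcosets (X m n)|"
    by metis
  define Y where "Y m = (INF i\<in>{..m}. X i)" for m
  have Y: "Y m \<in> C" for m
    unfolding Y_def using chain X(1) by (rule INF_atMost_in_chain)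
  have subgroup: "subgroup (V n) G" if "V \<in> C" for V
    using adaptedD(4)[OF small_adaptedD(1)[OF C(2)[OF that]]] .
  have "Y m n \<subseteq> X m n" for m
    by (auto simp: Y_def)
  then have "|rcosets (X m n)| \<le>o |rcosets (Y m n)|" for m
    by (rule card_of_rcosets_antimono[OF subgroup[OF Y] subgroup[OF X(1)]])
  then have "|A m| <o |rcosets (Y m n)|" for m
    using X(2) ordLess_ordLeq_trans by blast
  moreover have "antimono Y"
    unfolding Y_def by (intro antimonoI INF_superset_mono) auto
  ultimately show ?thesis
    using Y by blast
qed

lemma separating_tower_chain:
  assumes C: "C \<noteq> {}" "\<And>V. V \<in> C \<Longrightarrow> small_adapted V"
    and chain: "\<And>V W. V \<in> C \<Longrightarrow> W \<in> C \<Longrightarrow> V \<le> W \<or> W \<le> V"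
    and large: "\<not> |rcosets (Inf C n)| <o lam"
  shows "\<exists>W L. separating_tower W L (K n)"
proof -
  obtain A :: "nat \<Rightarrow> 'k set" where A: "\<And>m. |A m| <o lam"
    "\<And>M :: 'k set. |M| <o lam \<Longrightarrow> \<exists>m. |M| \<le>o |A m|"
    using cofinal_small_sets by metis
  obtain Y where Y: "antimono Y" "\<And>m. Y m \<in> C" "\<And>m. |A m| <o |rcosets (Y m n)|"
    using descending_sequence_of_unbounded_index[OF C chain large, of A] A(1) by blast
  note Y_adapted = small_adaptedD[OF C(2)[OF Y(2)]]
  have "small_refinement (\<lambda>m. Y m (max m n))"
    using complete_refinement_diagonal[OF Y(1) Y_adapted(2)] Y_adapted(4)
    by (simp add: small_refinement_def)
  moreover have "(\<lambda>m. Y m (max m n)) \<le> (\<lambda>m. Y m n)"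
    by (intro le_funI filtrationD(2)[OF Y_adapted(3)]) simp
  moreover have "unbounded_filtration (\<lambda>m. Y m n)"
    unfolding unbounded_filtration_def
  proof (intro conjI allI impI)
    show "filtration (\<lambda>m. Y m n)"
      unfolding filtration_def
      by (intro conjI allI antimonoI adaptedD(4)[OF Y_adapted(1)] le_funD[OF antimonoD[OF Y(1)]])
    show "\<exists>m. |M| <o |rcosets (Y m n)|" if "|M| <o lam" for M :: "'k set"
      using A(2)[OF that] Y(3) ordLeq_ordLess_trans by blast
  qed
  ultimately have "separating_tower (\<lambda>m. Y m (max m n)) (\<lambda>m. Y m n) (K n)"
    using adaptedD(6)[OF Y_adapted(1)] by (simp add: separating_tower_def)
  then show ?thesis
    by blast
qed

lemma ex_minimal_small_adapted:
  assumes no_tower: "\<nexists>W L n. separating_tower W L (K n)"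
  obtains V where "small_adapted V" "\<And>V'. small_adapted V' \<Longrightarrow> V' \<le> V \<Longrightarrow> V' = V"
proof -
  let ?A = "Collect small_adapted"
  have "\<exists>V\<in>?A. \<forall>V'\<in>?A. V \<ge> V' \<longrightarrow> V' = V"
  proof (rule predicate_Zorn)
    show "partial_order_on ?A (relation_of (\<ge>) ?A)"
      by (rule partial_order_on_relation_ofI) auto
    fix C assume C: "C \<in> Chains (relation_of (\<ge>) ?A)"
    show "\<exists>V\<in>?A. \<forall>V'\<in>C. V' \<ge> V"
    proof (cases "C = {}")
      case True
      then show ?thesis
        using adapted_U U_small by (auto simp: small_adapted_def)
    next
      case False
      have C_small_adapted: "small_adapted V" if "V \<in> C" for V
        using C that by (auto simp: Chains_def relation_of_def)
      have "V \<le> W \<or> W \<le> V" if "V \<in> C" "W \<in> C" for V W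
        using C that by (auto simp: Chains_def relation_of_def)
      then have "|rcosets (Inf C n)| <o lam" for n
        using separating_tower_chain[OF False C_small_adapted] no_tower by blast
      then have "small_adapted (Inf C)"
        using adapted_Inf[OF False small_adaptedD(1)[OF C_small_adapted]]
        by (simp add: small_adapted_def)
      then show ?thesis
        using Inf_lower by blast
    qed
  qed
  then show thesis
    using that by blast
qed

theorem ex_separating_tower:
  assumes large: "lam \<le>o |rcosets (\<sigma> ` carrier H)|"
  shows "\<exists>W L n. separating_tower W L (K n)"
proof (rule ccontr)
  assume no_tower: "\<not> ?thesis"
  then obtain V where V: "small_adapted V" "\<And>V'. small_adapted V' \<Longrightarrow> V' \<le> V \<Longrightarrow> V' = V"
    using ex_minimal_small_adapted by blast
  note V_adapted = small_adaptedD(1)[OF V(1)]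
  have "|rcosets (image_closure V n)| <o lam" for n
    using separating_tower_image_closure[OF V(1)] no_tower by blast
  then have "image_closure V = V"
    using adapted_image_closure[OF V_adapted] image_closure_le[OF V_adapted]
    by (intro V(2)) (simp_all add: small_adapted_def)
  then have "V 0 \<subseteq> \<sigma> ` carrier H"
    by (rule fixed_by_image_closure_subset_range[OF V_adapted])
  then have "|rcosets (\<sigma> ` carrier H)| \<le>o |rcosets (V 0)|"
    by (rule card_of_rcosets_antimono[OF adaptedD(4)[OF V_adapted] \<sigma>.img_is_subgroup])
  then have "|rcosets (\<sigma> ` carrier H)| <o lam"
    using small_adaptedD(4)[OF V(1)] by (rule small_mono)
  then show False
    using large not_ordLess_ordLeq by blast
qed

end

section \<open>Large incongruent sets\<close>

context small_filtered_group
begin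

lemma ex_separating_digits:
  fixes A :: "nat \<Rightarrow> 'k set"
  assumes V: "small_refinement V" and I: "finite I" "I \<noteq> {}"
    and L: "\<forall>t\<in>I. unbounded_filtration (L t)" and A: "\<And>n. |A n| <o lam"
  shows "\<exists>d e. strict_mono d \<and> (\<forall>n. inj_on (e n) (Pow (A n)) \<and> e n ` Pow (A n) \<subseteq> V (d n) \<and>
    incongruent I (\<lambda>t. L t (d (Suc n))) (e n ` Pow (A n)))"
proof -
  let ?digits = "\<lambda>n k m e. inj_on e (Pow (A n)) \<and> e ` Pow (A n) \<subseteq> V k \<and>
    incongruent I (\<lambda>t. L t m) (e ` Pow (A n))"
  have "\<exists>m>k. \<exists>e. ?digits n k m e" for n k
  proof -
    have "subgroup (V k) G"
      by (rule filtrationD(1)[OF small_refinementD(2)[OF V]])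
    then obtain m S where m: "m > k" "S \<subseteq> V k" "|Pow (A n)| \<le>o |S|" "incongruent I (\<lambda>t. L t m) S"
      using ex_incongruent_subset[OF _ small_refinementD(3)[OF V] I L small_Pow[OF A], where k = k]
      by blast
    then obtain e where "inj_on e (Pow (A n))" "e ` Pow (A n) \<subseteq> S"
      using card_of_ordLeq by metis
    then have "?digits n k m e"
      using m(2,4) pairwise_subset unfolding incongruent_def by blast
    then show ?thesis
      using m(1) by blast
  qed
  then have "\<exists>d. \<forall>n. d n < d (Suc n) \<and> (\<exists>e. ?digits n (d n) (d (Suc n)) e)"
    using dependent_nat_choice[of "\<lambda>_ _. True" "\<lambda>n k m. k < m \<and> (\<exists>e. ?digits n k m e)"] by simp
  then obtain d where d: "\<And>n. d n < d (Suc n)" "\<And>n. \<exists>e. ?digits n (d n) (d (Suc n)) e"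
    by blast
  have "strict_mono d"
    using d(1) by (simp add: strict_mono_Suc_iff)
  moreover have "\<exists>e. \<forall>n. ?digits n (d n) (d (Suc n)) (e n)"
    using d(2) by (intro choice) blast
  ultimately show ?thesis
    by blast
qed

lemma ex_common_refinement:
  assumes I: "finite I" "I \<noteq> {}" and tower: "\<forall>t\<in>I. separating_tower (W t) (L t) (Z t)"
  shows "\<exists>V. small_refinement V \<and> (\<forall>t\<in>I. V \<le> L t)"
proof -
  have "small_refinement (INF t\<in>I. W t)"
    using I tower by (intro small_refinement_Inf) (auto simp: separating_tower_def)
  moreover have "(INF t\<in>I. W t) \<le> L t" if "t \<in> I" for t
    using tower that by (intro INF_lower2[OF that]) (simp add: separating_tower_def)
  ultimately show ?thesis
    by blast
qed

lemma ex_separated_tree: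
  assumes I: "finite I" "I \<noteq> {}" and tower: "\<forall>t\<in>I. separating_tower (W t) (L t) (Z t)"
  obtains f :: "'k set \<Rightarrow> 'a" where "range f \<subseteq> carrier G"
    "\<And>X Y. \<lbrakk>X \<subseteq> Field lam; Y \<subseteq> Field lam; X \<noteq> Y\<rbrakk> \<Longrightarrow> \<exists>l. \<forall>t\<in>I. L t l #> f X \<noteq> L t l #> f Y"
proof -
  have L: "\<forall>t\<in>I. unbounded_filtration (L t)"
    using tower by (simp add: separating_tower_def)
  obtain A :: "nat \<Rightarrow> 'k set" where A: "\<And>n. |A n| <o lam" "(\<Union>n. A n) = Field lam"
    using cofinal_small_sets by metis
  obtain V where V: "small_refinement V" "\<forall>t\<in>I. V \<le> L t"
    using ex_common_refinement[OF I tower] by blast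
  obtain d e where d: "strict_mono d" and digits: "\<forall>n. inj_on (e n) (Pow (A n)) \<and>
      e n ` Pow (A n) \<subseteq> V (d n) \<and> incongruent I (\<lambda>t. L t (d (Suc n))) (e n ` Pow (A n))"
    using ex_separating_digits[OF V(1) I L, of A] A(1) by blast
  define a where "a X n = e n (X \<inter> A n)" for X n
  have "a X n \<in> (V \<circ> d) n" for X n
    using digits unfolding a_def comp_def by blast
  then obtain f where f: "range f \<subseteq> carrier G" "\<forall>X Y n L. subgroup L G \<longrightarrow> (V \<circ> d) (Suc n) \<subseteq> L \<longrightarrow>
      (\<forall>i<n. a X i = a Y i) \<longrightarrow> L #> a X n \<noteq> L #> a Y n \<longrightarrow> L #> f X \<noteq> L #> f Y"
    using ex_separated_limits[OF complete_refinementD(1)[OF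
        complete_refinement_subseq[OF small_refinementD(1)[OF V(1)] d]], of a] by blast
  have "\<exists>l. \<forall>t\<in>I. L t l #> f X \<noteq> L t l #> f Y"
    if XY: "X \<subseteq> Field lam" "Y \<subseteq> Field lam" "X \<noteq> Y" for X Y
  proof -
    obtain n where n: "X \<inter> A n \<noteq> Y \<inter> A n" "\<forall>i<n. X \<inter> A i = Y \<inter> A i"
      using first_trace_difference[of X A Y] XY by (auto simp: A(2))
    have "e n (X \<inter> A n) \<noteq> e n (Y \<inter> A n)"
      using digits n(1) by (metis inf_le2 PowI inj_onD)
    then have "L t (d (Suc n)) #> a X n \<noteq> L t (d (Suc n)) #> a Y n" if "t \<in> I" for t
      using digits that unfolding a_def incongruent_def pairwise_def
      by (metis PowI image_eqI inf_le2)
    moreover have "subgroup (L t (d (Suc n))) G" "(V \<circ> d) (Suc n) \<subseteq> L t (d (Suc n))"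
      if "t \<in> I" for t
      using filtrationD(1) L V(2) that by (simp_all add: unbounded_filtration_def le_fun_def)
    moreover have "\<forall>i<n. a X i = a Y i"
      using n(2) by (simp add: a_def)
    ultimately show ?thesis
      using f(2) by blast
  qed
  then show thesis
    using that f(1) by blast
qed

lemma ex_large_incongruent_set_of_towers:
  assumes I: "finite I" "I \<noteq> {}" and tower: "\<forall>t\<in>I. separating_tower (W t) (L t) (Z t)"
    and Z: "\<And>t. t \<in> I \<Longrightarrow> subgroup (Z t) G"
  obtains S where "S \<subseteq> carrier G" "|Pow (Field lam)| \<le>o |S|" "incongruent I Z S"
proof -
  obtain f :: "'k set \<Rightarrow> 'a" where f: "range f \<subseteq> carrier G"
    "\<And>X Y. \<lbrakk>X \<subseteq> Field lam; Y \<subseteq> Field lam; X \<noteq> Y\<rbrakk> \<Longrightarrow> \<exists>l. \<forall>t\<in>I. L t l #> f X \<noteq> L t l #> f Y"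
    using ex_separated_tree[OF I tower] by metis
  have neq: "Z t #> f X \<noteq> Z t #> f Y"
    if X: "X \<subseteq> Field lam" "Y \<subseteq> Field lam" "X \<noteq> Y" and t: "t \<in> I" for X Y t
  proof -
    obtain l where "L t l #> f X \<noteq> L t l #> f Y"
      using f(2)[OF X] t by blast
    moreover have "subgroup (L t l) G" "Z t \<subseteq> L t l"
      using tower t filtrationD(1) by (simp_all add: separating_tower_def unbounded_filtration_def)
    ultimately show ?thesis
      using rcoset_eq_mono[OF Z[OF t]] f(1) by blast
  qed
  have "inj_on f (Pow (Field lam))"
    using neq I(2) by (intro inj_onI) (metis PowD ex_in_conv)
  then have "|Pow (Field lam)| \<le>o |f ` Pow (Field lam)|"
    by (rule card_of_ordLeqI) blast
  moreover have "incongruent I Z (f ` Pow (Field lam))"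
    using neq unfolding incongruent_def pairwise_def by blast
  ultimately show thesis
    using f(1) by (intro that) auto
qed

end

lemma (in filtered_hom) card_of_range_congruent_ordLeq:
  assumes S: "S \<subseteq> carrier G" "pairwise (\<lambda>x y. K n #> x \<noteq> K n #> y) S" and y: "y \<in> carrier G"
  shows "|{x \<in> S. \<sigma> ` carrier H #> x = \<sigma> ` carrier H #> y}| \<le>o |rcosets\<^bsub>H\<^esub> (N n)|"
proof -
  let ?T = "{x \<in> S. \<sigma> ` carrier H #> x = \<sigma> ` carrier H #> y}"
  have "\<exists>a\<in>carrier H. x \<otimes> inv y = \<sigma> a" if "x \<in> ?T" for x
    using rcoset_eq_iff[OF \<sigma>.img_is_subgroup _ y] S(1) that by blast
  then obtain a where a: "\<And>x. x \<in> ?T \<Longrightarrow> a x \<in> carrier H \<and> x \<otimes> inv y = \<sigma> (a x)"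
    by metis
  have "inj_on (\<lambda>x. N n #>\<^bsub>H\<^esub> a x) ?T"
  proof (rule inj_onI)
    fix x x' assume x: "x \<in> ?T" "x' \<in> ?T" "N n #>\<^bsub>H\<^esub> a x = N n #>\<^bsub>H\<^esub> a x'"
    then have carrier: "x \<in> carrier G" "x' \<in> carrier G"
      and a_in: "a x \<in> carrier H" "a x' \<in> carrier H"
      using S(1) a by blast+
    have "a x \<otimes>\<^bsub>H\<^esub> inv\<^bsub>H\<^esub> a x' \<in> N n"
      using H.rcoset_eq_iff[OF H.U_subgroup a_in] x(3) by blast
    then have "\<sigma> (a x) \<otimes> inv \<sigma> (a x') \<in> K n"
      using a_in by (metis H.inv_closed \<sigma>.hom_inv \<sigma>.hom_mult imageI)
    then have "(x \<otimes> inv y) \<otimes> inv (x' \<otimes> inv y) \<in> K n"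
      using a[OF x(1)] a[OF x(2)] by simp
    also have "(x \<otimes> inv y) \<otimes> inv (x' \<otimes> inv y) = x \<otimes> inv x'"
      using carrier y by (simp add: inv_mult_group m_assoc) (simp add: m_assoc[symmetric])
    finally have "K n #> x = K n #> x'"
      using rcoset_eq_iff[OF K_subgroup carrier] by blast
    then show "x = x'"
      using S(2) x(1,2) by (auto simp: pairwise_def)
  qed
  then show ?thesis
    using a H.rcosetsI[OF N_carrier] by (intro card_of_ordLeqI) auto
qed

lemma (in filtered_group) card_of_images_congruent_ordLeq:
  assumes hom: "\<And>t. t \<in> I \<Longrightarrow> filtered_hom G U (H t) (N t) (\<sigma> t)"
    and S: "S \<subseteq> carrier G" "incongruent I (\<lambda>t. \<sigma> t ` N t (n t)) S" and y: "y \<in> carrier G"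
  shows "|{x \<in> S. \<exists>t\<in>I. \<sigma> t ` carrier (H t) #> x = \<sigma> t ` carrier (H t) #> y}|
    \<le>o |SIGMA t:I. rcosets\<^bsub>H t\<^esub> (N t (n t))|"
proof -
  let ?class = "\<lambda>t. {x \<in> S. \<sigma> t ` carrier (H t) #> x = \<sigma> t ` carrier (H t) #> y}"
  have "|?class t| \<le>o |rcosets\<^bsub>H t\<^esub> (N t (n t))|" if "t \<in> I" for t
    using S y that by (intro filtered_hom.card_of_range_congruent_ordLeq[OF hom[OF that]])
      (auto simp: incongruent_def pairwise_def)
  then have "|SIGMA t:I. ?class t| \<le>o |SIGMA t:I. rcosets\<^bsub>H t\<^esub> (N t (n t))|"
    by (intro card_of_Sigma_mono1) blast
  then have "|\<Union>t\<in>I. ?class t| \<le>o |SIGMA t:I. rcosets\<^bsub>H t\<^esub> (N t (n t))|"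
    by (rule ordLeq_transitive[OF card_of_UNION_Sigma])
  moreover have "{x \<in> S. \<exists>t\<in>I. \<sigma> t ` carrier (H t) #> x = \<sigma> t ` carrier (H t) #> y} =
      (\<Union>t\<in>I. ?class t)"
    by blast
  ultimately show ?thesis
    by simp
qed

theorem (in small_filtered_group) ex_large_incongruent_set:
  assumes I: "finite I" "I \<noteq> {}"
    and hom: "\<And>t. t \<in> I \<Longrightarrow> filtered_hom G U (H t) (N t) (\<sigma> t)"
    and small: "\<And>t. t \<in> I \<Longrightarrow> small_filtered_group (H t) (N t) lam"
    and large: "\<And>t. t \<in> I \<Longrightarrow> lam \<le>o |rcosets (\<sigma> t ` carrier (H t))|"
  obtains S where "S \<subseteq> carrier G" "|Pow (Field lam)| \<le>o |S|"
    "incongruent I (\<lambda>t. \<sigma> t ` carrier (H t)) S"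
proof -
  have "small_filtered_hom G U lam (H t) (N t) (\<sigma> t)" if "t \<in> I" for t
    using hom[OF that] small_filtered_group_axioms by (rule small_filtered_hom.intro)
  then have "\<exists>W L n. separating_tower W L (\<sigma> t ` N t n)" if "t \<in> I" for t
    using small_filtered_hom.ex_separating_tower large that by blast
  then obtain W L n where tower: "\<forall>t\<in>I. separating_tower (W t) (L t) (\<sigma> t ` N t (n t))"
    by metis
  have "subgroup (\<sigma> t ` N t (n t)) G" if "t \<in> I" for t
    using filtered_hom.K_subgroup[OF hom[OF that]] .
  then obtain S\<^sub>0 where S\<^sub>0: "S\<^sub>0 \<subseteq> carrier G" "|Pow (Field lam)| \<le>o |S\<^sub>0|"
    "incongruent I (\<lambda>t. \<sigma> t ` N t (n t)) S\<^sub>0"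
    using ex_large_incongruent_set_of_towers[OF I tower] by blast
  define R where "R x y \<longleftrightarrow> (\<exists>t\<in>I. \<sigma> t ` carrier (H t) #> x = \<sigma> t ` carrier (H t) #> y)" for x y
  define Q where "Q = (SIGMA t:I. rcosets\<^bsub>H t\<^esub> (N t (n t)))"
  have degree: "|{x \<in> S\<^sub>0. R x y}| \<le>o |Q|" if "y \<in> S\<^sub>0" for y
    unfolding R_def Q_def using S\<^sub>0(1,3) that by (intro card_of_images_congruent_ordLeq hom) auto
  have R: "symp_on S\<^sub>0 R" "reflp_on S\<^sub>0 R"
    using I(2) unfolding R_def symp_on_def reflp_on_def by (metis, blast)
  obtain S where S: "S \<subseteq> S\<^sub>0" "pairwise (\<lambda>x y. \<not> R x y) S" "|S\<^sub>0| \<le>o |S \<times> Q|"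
    by (rule large_independent_set[OF R degree])
  have "|Q| <o lam"
    unfolding Q_def using small_filtered_group.U_small[OF small] by (intro small_Sigma_finite I)
  then have "|Pow (Field lam)| \<le>o |S|"
    using Pow_ordLeq_if_ordLeq_Times_small ordLeq_transitive[OF S\<^sub>0(2) S(3)] by blast
  moreover have "incongruent I (\<lambda>t. \<sigma> t ` carrier (H t)) S"
    using S(2) by (simp add: incongruent_def R_def)
  ultimately show thesis
    using that S(1) S\<^sub>0(1) by blast
qed

theorem (in small_filtered_group) ex_family_modulo_images:
  assumes I: "finite I"
    and hom: "\<And>t. t \<in> I \<Longrightarrow> filtered_hom G U (H t) (N t) (\<sigma> t)"
    and small: "\<And>t. t \<in> I \<Longrightarrow> small_filtered_group (H t) (N t) lam"
    and families: "\<And>\<mu> :: 'k rel. \<lbrakk>Card_order \<mu>; \<mu> <o lam\<rbrakk> \<Longrightarrow>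
      \<exists>f\<in>Field \<mu> \<rightarrow> carrier G. \<forall>i\<in>Field \<mu>. \<forall>j\<in>Field \<mu>. i \<noteq> j \<longrightarrow>
        (\<forall>t\<in>I. f i \<otimes> inv (f j) \<notin> \<sigma> t ` carrier (H t))"
  shows "\<exists>f\<in>Field (ctwo ^c lam) \<rightarrow> carrier G.
    \<forall>i\<in>Field (ctwo ^c lam). \<forall>j\<in>Field (ctwo ^c lam). i \<noteq> j \<longrightarrow>
      (\<forall>t\<in>I. f i \<otimes> inv (f j) \<notin> \<sigma> t ` carrier (H t))"
proof (cases "I = {}")
  case True
  then show ?thesis
    by (intro bexI[of _ "\<lambda>_. \<one>"]) auto
next
  case False
  let ?F = "Field (ctwo ^c lam)"
  have image: "subgroup (\<sigma> t ` carrier (H t)) G" if "t \<in> I" for t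
    using group_hom.img_is_subgroup[OF filtered_hom.axioms(3)[OF hom[OF that]]] .
  have "lam \<le>o |rcosets (\<sigma> t ` carrier (H t))|" if t: "t \<in> I" for t
  proof (rule large_index_if_incongruent_families[OF image[OF t]])
    fix M :: "'k set" assume M: "|M| <o lam"
    show "\<exists>f\<in>M \<rightarrow> carrier G. \<forall>i\<in>M. \<forall>j\<in>M. i \<noteq> j \<longrightarrow> f i \<otimes> inv (f j) \<notin> \<sigma> t ` carrier (H t)"
      using families[OF card_of_Card_order M, unfolded Field_card_of] t by blast
  qed
  then obtain S where S: "S \<subseteq> carrier G" "|Pow (Field lam)| \<le>o |S|"
    "incongruent I (\<lambda>t. \<sigma> t ` carrier (H t)) S"
    using ex_large_incongruent_set[where H = H and N = N and \<sigma> = \<sigma>, OF I False hom small] by blast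
  have "|?F| =o |Pow (Field lam)|"
    using card_of_Field_ordIso[OF Card_order_cexp] Pow_Field_ordIso_ctwo_cexp
      ordIso_symmetric ordIso_transitive by blast
  then obtain f where f: "inj_on f ?F" "f ` ?F \<subseteq> S"
    using card_of_ordLeq ordIso_ordLeq_trans[OF _ S(2)] by metis
  have "f i \<otimes> inv (f j) \<notin> \<sigma> t ` carrier (H t)" if "i \<in> ?F" "j \<in> ?F" "i \<noteq> j" "t \<in> I" for i j t
  proof -
    have "f i \<in> S" "f j \<in> S" "f i \<noteq> f j"
      using f that(1-3) by (auto simp: inj_on_def)
    then show ?thesis
      using S(1,3) rcoset_eq_iff[OF image] that(4) unfolding incongruent_def pairwise_def by blast
  qed
  then show ?thesis
    using f(2) S(1) by (intro bexI[of _ f]) auto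
qed

section \<open>Inverse limits\<close>

definition limit_kernel :: "(nat \<Rightarrow> 'a monoid) \<Rightarrow> (nat \<Rightarrow> nat \<Rightarrow> 'a \<Rightarrow> 'a) \<Rightarrow> nat \<Rightarrow> (nat \<Rightarrow> 'a) set" where
  "limit_kernel G \<pi> n = kernel (inverse_limit G \<pi>) (G n) (limit_proj n)"

lemma group_hom_limit_proj:
  assumes "inverse_system G \<pi>"
  shows "group_hom (inverse_limit G \<pi>) (G n) (limit_proj n)"
  using assms group_inverse_limit[OF assms] limit_proj_hom
  by (auto simp: group_hom_def group_hom_axioms_def inverse_system_def)

lemma limit_kernel_rcoset_eq_iff:
  assumes sys: "inverse_system G \<pi>"
    and x: "x \<in> carrier (inverse_limit G \<pi>)" and y: "y \<in> carrier (inverse_limit G \<pi>)"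
  shows "limit_kernel G \<pi> n #>\<^bsub>inverse_limit G \<pi>\<^esub> x = limit_kernel G \<pi> n #>\<^bsub>inverse_limit G \<pi>\<^esub> y
    \<longleftrightarrow> x n = y n"
proof -
  interpret group_hom "inverse_limit G \<pi>" "G n" "limit_proj n"
    using group_hom_limit_proj[OF sys] .
  have carrier: "limit_proj n x \<in> carrier (G n)" "limit_proj n y \<in> carrier (G n)"
    using x y by simp_all
  have "limit_kernel G \<pi> n #>\<^bsub>inverse_limit G \<pi>\<^esub> x = limit_kernel G \<pi> n #>\<^bsub>inverse_limit G \<pi>\<^esub> y \<longleftrightarrow>
      limit_proj n x \<otimes>\<^bsub>G n\<^esub> inv\<^bsub>G n\<^esub> limit_proj n y = \<one>\<^bsub>G n\<^esub>"
    unfolding limit_kernel_def using G.rcoset_eq_iff[OF subgroup_kernel x y] x y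
    by (simp add: kernel_def)
  also have "\<dots> \<longleftrightarrow> limit_proj n x = limit_proj n y"
    using carrier by (metis H.inv_equality H.inv_inv H.inv_closed H.r_inv)
  finally show ?thesis
    by (simp add: limit_proj_def)
qed

lemma filtration_limit_kernel:
  assumes sys: "inverse_system G \<pi>"
  shows "group.filtration (inverse_limit G \<pi>) (limit_kernel G \<pi>)"
proof -
  have "limit_kernel G \<pi> n \<subseteq> limit_kernel G \<pi> m" if "m \<le> n" for m n
  proof
    fix x assume x: "x \<in> limit_kernel G \<pi> n"
    have "\<pi> m n \<one>\<^bsub>G n\<^esub> = \<one>\<^bsub>G m\<^esub>"
      using sys that by (intro hom_one) (auto simp: inverse_system_def)
    moreover have "\<pi> m n (x n) = x m"
      using x that by (auto simp: limit_kernel_def kernel_def carrier_inverse_limit)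
    ultimately show "x \<in> limit_kernel G \<pi> m"
      using x by (auto simp: limit_kernel_def kernel_def limit_proj_def)
  qed
  then show ?thesis
    using group_hom.subgroup_kernel[OF group_hom_limit_proj[OF sys]]
    by (auto simp: group.filtration_def[OF group_inverse_limit[OF sys]] limit_kernel_def
        antimono_def)
qed

lemma complete_filtration_limit_kernel:
  assumes sys: "inverse_system G \<pi>"
  shows "group.complete_filtration (inverse_limit G \<pi>) (limit_kernel G \<pi>)"
proof -
  let ?G = "inverse_limit G \<pi>" and ?U = "limit_kernel G \<pi>"
  interpret group ?G
    using group_inverse_limit[OF sys] .
  have "\<exists>g. coset_limit ?U y g" if y: "coherent ?U y" for y
  proof -
    note y_carrier = coherentD(1)[OF y]
    note rcoset_iff = limit_kernel_rcoset_eq_iff[OF sys _ y_carrier]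
    have "\<pi> m n (y n n) = y m m" if "m \<le> n" for m n
    proof -
      have "\<pi> m n (y n n) = y n m"
        using y_carrier[of n] that by (simp add: carrier_inverse_limit)
      also have "\<dots> = y m m"
        using coherent_rcoset_eq[OF filtration_limit_kernel[OF sys] y that] rcoset_iff[OF y_carrier]
        by blast
      finally show ?thesis .
    qed
    moreover have "y n n \<in> carrier (G n)" for n
      using y_carrier[of n] by (simp add: carrier_inverse_limit)
    ultimately have "(\<lambda>n. y n n) \<in> carrier ?G"
      by (simp add: carrier_inverse_limit)
    then have "coset_limit ?U y (\<lambda>n. y n n)"
      using rcoset_iff by (simp add: coset_limit_def)
    then show ?thesis
      by blast
  qed
  then show ?thesis
    using filtration_limit_kernel[OF sys] by (simp add: complete_filtration_def)
qed

lemma filtered_group_inverse_limit: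
  assumes sys: "inverse_system G \<pi>"
  shows "filtered_group (inverse_limit G \<pi>) (limit_kernel G \<pi>)"
proof -
  let ?G = "inverse_limit G \<pi>" and ?U = "limit_kernel G \<pi>"
  show ?thesis
  proof (intro filtered_group.intro filtered_group_axioms.intro)
    show "group ?G"
      using group_inverse_limit[OF sys] .
    show "?U n \<lhd> ?G" for n
      unfolding limit_kernel_def using group_hom.normal_kernel[OF group_hom_limit_proj[OF sys]] .
    show "group.complete_filtration ?G ?U"
      using complete_filtration_limit_kernel[OF sys] .
    have "\<one>\<^bsub>?G\<^esub> n = \<one>\<^bsub>G n\<^esub>" for n
      using group_hom.hom_one[OF group_hom_limit_proj[OF sys]] by (simp add: limit_proj_def)
    moreover have "\<one>\<^bsub>?G\<^esub> \<in> carrier ?G"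
      using monoid.one_closed[OF group.is_monoid[OF group_inverse_limit[OF sys]]] .
    ultimately show "(\<Inter>n. ?U n) = {\<one>\<^bsub>?G\<^esub>}"
      by (auto simp: limit_kernel_def kernel_def limit_proj_def fun_eq_iff)
  qed
qed

lemma small_filtered_group_inverse_limit:
  assumes sys: "inverse_system G \<pi>" and lam: "strong_limit_omega lam"
    and small: "\<And>n. |carrier (G n)| <o lam"
  shows "small_filtered_group (inverse_limit G \<pi>) (limit_kernel G \<pi>) lam"
proof -
  let ?G = "inverse_limit G \<pi>"
  interpret filtered_group ?G "limit_kernel G \<pi>"
    using filtered_group_inverse_limit[OF sys] .
  interpret strong_limit_omega lam
    by (fact lam)
  show ?thesis
  proof
    fix n
    have "|rcosets\<^bsub>?G\<^esub> (limit_kernel G \<pi> n)| \<le>o |(\<lambda>x. x n) ` carrier ?G|"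
      by (rule card_of_rcosets_ordLeq_image) (simp add: limit_kernel_rcoset_eq_iff[OF sys])
    also have "|(\<lambda>x. x n) ` carrier ?G| \<le>o |carrier (G n)|"
      by (rule card_of_mono1) (auto simp: carrier_inverse_limit)
    finally show "|rcosets\<^bsub>?G\<^esub> (limit_kernel G \<pi> n)| <o lam"
      using small by (rule small_mono)
  qed
qed

lemma filtered_hom_limit_map:
  assumes G: "inverse_system G \<pi>" and H: "inverse_system H \<rho>"
    and \<sigma>: "inverse_system_hom H \<rho> G \<pi> \<sigma>"
  shows "filtered_hom (inverse_limit G \<pi>) (limit_kernel G \<pi>)
    (inverse_limit H \<rho>) (limit_kernel H \<rho>) (limit_map \<sigma>)"
proof (intro filtered_hom.intro filtered_hom_axioms.intro)
  show hom: "group_hom (inverse_limit H \<rho>) (inverse_limit G \<pi>) (limit_map \<sigma>)"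
    using limit_map_hom[OF \<sigma>] group_inverse_limit[OF G] group_inverse_limit[OF H]
    by (simp add: group_hom_def group_hom_axioms_def)
  fix n
  have "\<sigma> n \<one>\<^bsub>H n\<^esub> = \<one>\<^bsub>G n\<^esub>"
    using G H \<sigma> by (intro hom_one) (auto simp: inverse_system_hom_def inverse_system_def)
  then show "limit_map \<sigma> ` limit_kernel H \<rho> n \<subseteq> limit_kernel G \<pi> n"
    using group_hom.hom_closed[OF hom]
    by (auto simp: limit_kernel_def kernel_def limit_proj_def limit_map_def)
qed (fact filtered_group_inverse_limit[OF G] filtered_group_inverse_limit[OF H])+

theorem theorem1p1:
  fixes lam :: "'k rel"
    and G :: "nat \<Rightarrow> 'a monoid" and \<pi> :: "nat \<Rightarrow> nat \<Rightarrow> 'a \<Rightarrow> 'a"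
    and I :: "'i set"
    and H :: "'i \<Rightarrow> nat \<Rightarrow> 'b monoid" and \<rho> :: "'i \<Rightarrow> nat \<Rightarrow> nat \<Rightarrow> 'b \<Rightarrow> 'b"
    and \<sigma> :: "'i \<Rightarrow> nat \<Rightarrow> 'b \<Rightarrow> 'a"
  assumes "Card_order lam"
    and "lam =o natLeq \<or> (strong_limit_card lam \<and> has_cofinality lam natLeq)"
    and "inverse_system G \<pi>"
    and "\<And>n. |carrier (G n)| <o lam"
    and "finite I"
    and "\<And>t. t \<in> I \<Longrightarrow> inverse_system (H t) (\<rho> t)"
    and "\<And>t n. t \<in> I \<Longrightarrow> |carrier (H t n)| <o lam"
    and "\<And>t. t \<in> I \<Longrightarrow> inverse_system_hom (H t) (\<rho> t) G \<pi> (\<sigma> t)"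
    and "\<And>\<mu> :: 'k rel. \<lbrakk>Card_order \<mu>; \<mu> <o lam\<rbrakk> \<Longrightarrow>
           \<exists>f \<in> Field \<mu> \<rightarrow> carrier (inverse_limit G \<pi>).
             \<forall>i \<in> Field \<mu>. \<forall>j \<in> Field \<mu>. i \<noteq> j \<longrightarrow>
               (\<forall>t \<in> I. f i \<otimes>\<^bsub>inverse_limit G \<pi>\<^esub> inv\<^bsub>inverse_limit G \<pi>\<^esub> (f j)
                  \<notin> limit_map (\<sigma> t) ` carrier (inverse_limit (H t) (\<rho> t)))"
  shows "\<exists>f \<in> Field (ctwo ^c lam) \<rightarrow> carrier (inverse_limit G \<pi>).
           \<forall>i \<in> Field (ctwo ^c lam). \<forall>j \<in> Field (ctwo ^c lam). i \<noteq> j \<longrightarrow>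
             (\<forall>t \<in> I. f i \<otimes>\<^bsub>inverse_limit G \<pi>\<^esub> inv\<^bsub>inverse_limit G \<pi>\<^esub> (f j)
                \<notin> limit_map (\<sigma> t) ` carrier (inverse_limit (H t) (\<rho> t)))"
proof -
  have lam: "strong_limit_omega lam"
    using assms(1,2) strong_limit_omega_if_ordIso_natLeq strong_limit_omega_if_strong_limit_card
    by blast
  interpret small_filtered_group "inverse_limit G \<pi>" "limit_kernel G \<pi>" lam
    using assms(3) lam assms(4) by (rule small_filtered_group_inverse_limit)
  show ?thesis
  proof (rule ex_family_modulo_images[where N = "\<lambda>t. limit_kernel (H t) (\<rho> t)"])
    fix t assume t: "t \<in> I"
    show "filtered_hom (inverse_limit G \<pi>) (limit_kernel G \<pi>)
        (inverse_limit (H t) (\<rho> t)) (limit_kernel (H t) (\<rho> t)) (limit_map (\<sigma> t))"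
      using assms(3) assms(6,8)[OF t] by (rule filtered_hom_limit_map)
    show "small_filtered_group (inverse_limit (H t) (\<rho> t)) (limit_kernel (H t) (\<rho> t)) lam"
      using assms(6)[OF t] lam assms(7)[OF t] by (rule small_filtered_group_inverse_limit)
  qed (fact assms(5,9))+
qed

end
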